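(* Let $\Omega\subset\mathbb{R}^2$ be open and bounded, $\mathcal{H}=L^2(\Omega,\mathbb{R}^2)$, and for $u\in\mathcal{H}$ let $$J(u):=\sup\Big\{-\int_\Omega u\cdot\nabla v\,\mathrm{d}x : v\in C_c^\infty(\Omega,[-1,1])\Big\},\qquad \tilde J(u):=\sup\Big\{\int_\Omega u\cdot\nabla^\perp v\,\mathrm{d}x : v\in C_c^\infty(\Omega,[-1,1])\Big\},$$ $$\mathcal{J}(u):=J(u)+\tilde J(u),$$ where $\nabla^\perp=(\partial_2,-\partial_1)^T$. Then the gradient flow $\partial_tu(t)=-p(t)$, $p(t)\in\partial\mathcal{J}(u(t))$ with $u(0)=f$ yields a sequence of eigenvectors $p(t)$ for $t>0$, i.e. $p(t)\in\partial\mathcal{J}(p(t))$ for all $t>0$. Furthermore, $(1-\Pi_\sigma)p(t)$ and $\Pi_\sigma p(t)$ are eigenvectors of $\partial J$ and $\partial\tilde J$, respectively, where $\Pi_\sigma$ is the Helmholtz projection.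
   Context: For a convex, lower semicontinuous functional $\Phi:\mathcal{H}\to\mathbb{R}\cup\{+\infty\}$ on $\mathcal{H}=L^2(\Omega,\mathbb{R}^2)$ that is absolutely one-homogeneous, i.e. $\Phi(cu)=|c|\Phi(u)$ for all $u\in\mathcal{H}$, $c\in\mathbb{R}\setminus\{0\}$, and $\Phi(0)=0$ (such as $\Phi=J$, $\Phi=\tilde J$ or $\Phi=\mathcal{J}$), the subdifferential is $\partial\Phi(u)=\{p\in\mathcal{H}:\langle p,v\rangle\le\Phi(v)\ \forall v\in\mathcal{H},\ \langle p,u\rangle=\Phi(u)\}$, with $\langle\cdot,\cdot\rangle$ the $L^2$ inner product, and $\mathrm{dom}(\partial\Phi)=\{u:\partial\Phi(u)\ne\emptyset\}$. A vector $u$ is an eigenvector of $\partial\Phi$ with eigenvalue $\lambda\in\mathbb{R}$ if $\lambda u\in\partial\Phi(u)$. $C_c^\infty(\Omega,[-1,1])$ is the set of smooth compactly supported functions on $\Omega$ with values in $[-1,1]$. The Helmholtz projection $\Pi_\sigma$ is the orthogonal projection of $L^2(\Omega,\mathbb{R}^2)$ onto the closed subspace $L^2_\sigma(\Omega,\mathbb{R}^2)$, the $L^2$-closure of $\{\varphi\in C_c^\infty(\Omega,\mathbb{R}^2):\mathrm{div}\,\varphi=0\}$. Gradient flow of $\Phi$ (here applied with $\Phi=\mathcal{J}$): for $f\in\overline{\mathrm{dom}(\partial\Phi)}$, the solution $(u,p)$ of $\partial_tu(t)=-p(t)$, $p(t)\in\partial\Phi(u(t))$, $u(0)=f$ is the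 unique continuous $u:[0,\infty)\to\mathcal{H}$ with $u(0)=f$ given by Brezis' theory (Lipschitz on $[\delta,\infty)$ for every $\delta>0$, $u(t)\in\mathrm{dom}(\partial\Phi)$ for all $t>0$, right-differentiable at every $t>0$), together with $p(t):=-\partial_t^+u(t)$, which is the element of minimal norm in $\partial\Phi(u(t))$ for every $t>0$. *)

theory Defs
  imports "HOL-Analysis.Analysis"
begin

section \<open>The Hilbert space of square-integrable planar vector fields\<close>

definition sq_integrable :: "(real^2 \<Rightarrow> real^2) \<Rightarrow> bool" where
  "sq_integrable u \<longleftrightarrow> u \<in> borel_measurable lebesgue \<and> integrable lebesgue (\<lambda>x. (norm (u x))\<^sup>2)"

definition L2_eq :: "(real^2 \<Rightarrow> real^2) \<Rightarrow> (real^2 \<Rightarrow> real^2) \<Rightarrow> bool" where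
  "L2_eq u v \<longleftrightarrow> sq_integrable u \<and> sq_integrable v \<and> (AE x in lebesgue. u x = v x)"

lemma sq_integrable_0: "sq_integrable (\<lambda>x. 0)"
  by (simp add: sq_integrable_def)

lemma sq_integrable_add:
  assumes "sq_integrable u" "sq_integrable v"
  shows "sq_integrable (\<lambda>x. u x + v x)"
proof -
  have [measurable]: "u \<in> borel_measurable lebesgue" "v \<in> borel_measurable lebesgue"
    using assms by (auto simp: sq_integrable_def)
  have le: "(norm (a + b))\<^sup>2 \<le> 2 * (norm a)\<^sup>2 + 2 * (norm b)\<^sup>2" for a b :: "real^2"
  proof -
    have "(norm (a + b))\<^sup>2 \<le> (norm a + norm b)\<^sup>2"
      by (simp add: norm_triangle_ineq power_mono)
    also have "\<dots> \<le> 2 * (norm a)\<^sup>2 + 2 * (norm b)\<^sup>2"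
      using zero_le_power2[of "norm a - norm b"] by (simp add: power2_eq_square algebra_simps)
    finally show ?thesis .
  qed
  have "integrable lebesgue (\<lambda>x. (norm (u x + v x))\<^sup>2)"
  proof (rule Bochner_Integration.integrable_bound)
    show "integrable lebesgue (\<lambda>x. 2 * (norm (u x))\<^sup>2 + 2 * (norm (v x))\<^sup>2)"
      using assms by (auto simp: sq_integrable_def)
    show "(\<lambda>x. (norm (u x + v x))\<^sup>2) \<in> borel_measurable lebesgue"
      by measurable
    show "AE x in lebesgue. norm ((norm (u x + v x))\<^sup>2) \<le> norm (2 * (norm (u x))\<^sup>2 + 2 * (norm (v x))\<^sup>2)"
      using le by simp
  qed
  then show ?thesis by (simp add: sq_integrable_def)
qed

lemma sq_integrable_scaleR:
  assumes "sq_integrable u"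
  shows "sq_integrable (\<lambda>x. c *\<^sub>R u x)"
proof -
  have [measurable]: "u \<in> borel_measurable lebesgue"
    using assms by (auto simp: sq_integrable_def)
  show ?thesis
    using assms by (simp add: sq_integrable_def power_mult_distrib)
qed

lemma sq_integrable_inner:
  assumes "sq_integrable u" "sq_integrable v"
  shows "integrable lebesgue (\<lambda>x. u x \<bullet> v x)"
proof -
  have [measurable]: "u \<in> borel_measurable lebesgue" "v \<in> borel_measurable lebesgue"
    using assms by (auto simp: sq_integrable_def)
  have le: "\<bar>a \<bullet> b\<bar> \<le> (norm a)\<^sup>2 + (norm b)\<^sup>2" for a b :: "real^2"
  proof -
    have "\<bar>a \<bullet> b\<bar> \<le> norm a * norm b" by (rule Cauchy_Schwarz_ineq2)
    also have "\<dots> \<le> (norm a)\<^sup>2 + (norm b)\<^sup>2"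
      using sum_squares_bound[of "norm a" "norm b"] mult_nonneg_nonneg[OF norm_ge_zero[of a] norm_ge_zero[of b]]
      by linarith
    finally show ?thesis .
  qed
  show ?thesis
  proof (rule Bochner_Integration.integrable_bound)
    show "integrable lebesgue (\<lambda>x. (norm (u x))\<^sup>2 + (norm (v x))\<^sup>2)"
      using assms by (auto simp: sq_integrable_def)
    show "(\<lambda>x. u x \<bullet> v x) \<in> borel_measurable lebesgue"
      by measurable
    show "AE x in lebesgue. norm (u x \<bullet> v x) \<le> norm ((norm (u x))\<^sup>2 + (norm (v x))\<^sup>2)"
      using le by simp
  qed
qed

quotient_type L2 = "real^2 \<Rightarrow> real^2" / partial: L2_eq
proof (rule part_equivpI)
  show "\<exists>u. L2_eq u u"
    using sq_integrable_0 by (auto simp: L2_eq_def)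
  show "symp L2_eq"
    by (auto simp: symp_def L2_eq_def)
  show "transp L2_eq"
    by (auto simp: transp_def L2_eq_def)
qed

instantiation L2 :: real_inner
begin

lift_definition zero_L2 :: L2 is "\<lambda>x. 0"
  by (simp add: L2_eq_def sq_integrable_0)

lift_definition plus_L2 :: "L2 \<Rightarrow> L2 \<Rightarrow> L2" is "\<lambda>u v x. u x + v x"
  unfolding L2_eq_def using sq_integrable_add by (auto elim: eventually_elim2)

lift_definition scaleR_L2 :: "real \<Rightarrow> L2 \<Rightarrow> L2" is "\<lambda>c u x. c *\<^sub>R u x"
  by (auto simp: L2_eq_def sq_integrable_scaleR elim: eventually_mono)

lift_definition inner_L2 :: "L2 \<Rightarrow> L2 \<Rightarrow> real" is "\<lambda>u v. LINT x|lebesgue. u x \<bullet> v x"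
proof -
  fix u u' v v' :: "real^2 \<Rightarrow> real^2"
  assume *: "L2_eq u u'" "L2_eq v v'"
  have [measurable]: "u \<in> borel_measurable lebesgue" "v \<in> borel_measurable lebesgue"
      "u' \<in> borel_measurable lebesgue" "v' \<in> borel_measurable lebesgue"
    using * by (auto simp: L2_eq_def sq_integrable_def)
  have ae: "AE x in lebesgue. u x = u' x" "AE x in lebesgue. v x = v' x"
    using * by (auto simp: L2_eq_def)
  show "(LINT x|lebesgue. u x \<bullet> v x) = (LINT x|lebesgue. u' x \<bullet> v' x)"
  proof (rule integral_cong_AE)
    show "AE x in lebesgue. u x \<bullet> v x = u' x \<bullet> v' x"
      using ae by eventually_elim simp
  qed measurable
qed

definition uminus_L2 :: "L2 \<Rightarrow> L2" where "uminus_L2 u = (-1) *\<^sub>R u"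
definition minus_L2 :: "L2 \<Rightarrow> L2 \<Rightarrow> L2" where "minus_L2 u v = u + (-1) *\<^sub>R v"
definition norm_L2 :: "L2 \<Rightarrow> real" where "norm_L2 u = sqrt (u \<bullet> u)"
definition sgn_L2 :: "L2 \<Rightarrow> L2" where "sgn_L2 u = inverse (norm u) *\<^sub>R u"
definition dist_L2 :: "L2 \<Rightarrow> L2 \<Rightarrow> real" where "dist_L2 u v = norm (u - v)"
definition uniformity_L2 :: "(L2 \<times> L2) filter" where
  "uniformity_L2 = (INF e\<in>{0<..}. principal {(u, v). dist u v < e})"
definition open_L2 :: "L2 set \<Rightarrow> bool" where
  "open_L2 U \<longleftrightarrow> (\<forall>x\<in>U. \<forall>\<^sub>F (x', y) in uniformity. x' = x \<longrightarrow> y \<in> U)"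

instance
proof
  fix u v w :: L2 and a b :: real
  show "u + v + w = u + (v + w)"
    by transfer (simp add: L2_eq_def sq_integrable_add add.assoc)
  show "u + v = v + u"
    by transfer (simp add: L2_eq_def sq_integrable_add add.commute)
  show "0 + u = u"
    by transfer (simp add: L2_eq_def)
  show "- u + u = 0"
    unfolding uminus_L2_def
    by transfer (simp add: L2_eq_def sq_integrable_0)
  show "u - v = u + - v"
    by (simp add: uminus_L2_def minus_L2_def)
  show "a *\<^sub>R (u + v) = a *\<^sub>R u + a *\<^sub>R v"
    by transfer (simp add: L2_eq_def sq_integrable_add sq_integrable_scaleR scaleR_add_right)
  show "(a + b) *\<^sub>R u = a *\<^sub>R u + b *\<^sub>R u"
    by transfer (simp add: L2_eq_def sq_integrable_add sq_integrable_scaleR flip: scaleR_add_left)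
  show "a *\<^sub>R b *\<^sub>R u = (a * b) *\<^sub>R u"
    by transfer (simp add: L2_eq_def sq_integrable_scaleR)
  show "1 *\<^sub>R u = u"
    by transfer (simp add: L2_eq_def)
  show "dist u v = norm (u - v)" by (rule dist_L2_def)
  show "sgn u = inverse (norm u) *\<^sub>R u" by (simp add: sgn_L2_def)
  show "uniformity = (INF e\<in>{0<..}. principal {(u :: L2, v). dist u v < e})"
    by (rule uniformity_L2_def)
  show "open U \<longleftrightarrow> (\<forall>x\<in>U. \<forall>\<^sub>F (x', y) in uniformity. x' = x \<longrightarrow> y \<in> U)" for U :: "L2 set"
    by (rule open_L2_def)
  show "u \<bullet> v = v \<bullet> u"
    by transfer (simp add: inner_commute)
  show "(u + v) \<bullet> w = u \<bullet> w + v \<bullet> w"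
    by transfer (simp add: L2_eq_def inner_add_left sq_integrable_inner)
  show "(a *\<^sub>R u) \<bullet> v = a * (u \<bullet> v)"
    by transfer simp
  show "0 \<le> u \<bullet> u"
    by transfer simp
  show "u \<bullet> u = 0 \<longleftrightarrow> u = 0"
  proof (transfer)
    fix u :: "real^2 \<Rightarrow> real^2"
    assume "L2_eq u u"
    then have u: "sq_integrable u" by (simp add: L2_eq_def)
    have "(LINT x|lebesgue. u x \<bullet> u x) = 0 \<longleftrightarrow> (AE x in lebesgue. u x \<bullet> u x = 0)"
      by (rule integral_nonneg_eq_0_iff_AE) (simp_all add: sq_integrable_inner u)
    then show "(LINT x|lebesgue. u x \<bullet> u x) = 0 \<longleftrightarrow> L2_eq u (\<lambda>x. 0)"
      using u by (simp add: L2_eq_def sq_integrable_0)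
  qed
  show "norm u = sqrt (u \<bullet> u)" by (rule norm_L2_def)
qed

end

text \<open>
  The space of square-integrable fields on \<^term>\<open>\<Omega>\<close> is identified, via extension by zero,
  with the closed subspace of those classes on the plane that vanish almost everywhere
  outside \<^term>\<open>\<Omega>\<close>. The function \<^term>\<open>rep_L2\<close> picks some representative of a class; it is
  used below only where the result does not depend on that choice.
\<close>

definition L2_on :: "(real^2) set \<Rightarrow> L2 set" where
  "L2_on \<Omega> = {u. AE x in lebesgue. x \<notin> \<Omega> \<longrightarrow> rep_L2 u x = 0}"


section \<open>Smooth compactly supported functions\<close>

definition partial :: "2 \<Rightarrow> (real^2 \<Rightarrow> real) \<Rightarrow> real^2 \<Rightarrow> real" where
  "partial i v x = frechet_derivative v (at x) (axis i 1)"

primrec Ck :: "nat \<Rightarrow> (real^2 \<Rightarrow> real) \<Rightarrow> bool" where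
  "Ck 0 v \<longleftrightarrow> continuous_on UNIV v"
| "Ck (Suc k) v \<longleftrightarrow> (\<forall>x. v differentiable (at x)) \<and> (\<forall>i. Ck k (partial i v))"

definition smooth :: "(real^2 \<Rightarrow> real) \<Rightarrow> bool" where
  "smooth v \<longleftrightarrow> (\<forall>k. Ck k v)"

text \<open>Test functions on \<^term>\<open>\<Omega>\<close> are represented by their extension by zero to the plane.\<close>

definition compactly_supported :: "(real^2) set \<Rightarrow> (real^2 \<Rightarrow> 'b::zero) \<Rightarrow> bool" where
  "compactly_supported \<Omega> v \<longleftrightarrow> compact (closure {x. v x \<noteq> 0}) \<and> closure {x. v x \<noteq> 0} \<subseteq> \<Omega>"

definition Cc_smooth_unit :: "(real^2) set \<Rightarrow> (real^2 \<Rightarrow> real) set" where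
  "Cc_smooth_unit \<Omega> = {v. smooth v \<and> compactly_supported \<Omega> v \<and> (\<forall>x. v x \<in> {-1..1})}"

definition Cc_smooth_field :: "(real^2) set \<Rightarrow> (real^2 \<Rightarrow> real^2) set" where
  "Cc_smooth_field \<Omega> = {\<phi>. (\<forall>i. smooth (\<lambda>x. \<phi> x $ i)) \<and> compactly_supported \<Omega> \<phi>}"

definition grad :: "(real^2 \<Rightarrow> real) \<Rightarrow> real^2 \<Rightarrow> real^2" where
  "grad v x = vector [partial 1 v x, partial 2 v x]"

definition perp_grad :: "(real^2 \<Rightarrow> real) \<Rightarrow> real^2 \<Rightarrow> real^2" where
  "perp_grad v x = vector [partial 2 v x, - partial 1 v x]"

definition divergence :: "(real^2 \<Rightarrow> real^2) \<Rightarrow> real^2 \<Rightarrow> real" where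
  "divergence \<phi> x = (\<Sum>i\<in>UNIV. partial i (\<lambda>y. \<phi> y $ i) x)"


section \<open>The functionals and the Helmholtz projection\<close>

definition J_div :: "(real^2) set \<Rightarrow> L2 \<Rightarrow> ereal" where
  "J_div \<Omega> u = (SUP v\<in>Cc_smooth_unit \<Omega>. ereal (- (LINT x:\<Omega>|lebesgue. rep_L2 u x \<bullet> grad v x)))"

definition J_rot :: "(real^2) set \<Rightarrow> L2 \<Rightarrow> ereal" where
  "J_rot \<Omega> u = (SUP v\<in>Cc_smooth_unit \<Omega>. ereal (LINT x:\<Omega>|lebesgue. rep_L2 u x \<bullet> perp_grad v x))"

definition J_sum :: "(real^2) set \<Rightarrow> L2 \<Rightarrow> ereal" where
  "J_sum \<Omega> u = J_div \<Omega> u + J_rot \<Omega> u"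

definition L2_sigma :: "(real^2) set \<Rightarrow> L2 set" where
  "L2_sigma \<Omega> = closure (abs_L2 ` {\<phi> \<in> Cc_smooth_field \<Omega>. \<forall>x. divergence \<phi> x = 0})"

definition helmholtz :: "(real^2) set \<Rightarrow> L2 \<Rightarrow> L2" where
  "helmholtz \<Omega> u = (THE q. q \<in> L2_sigma \<Omega> \<and> (\<forall>w\<in>L2_sigma \<Omega>. orthogonal (u - q) w))"


section \<open>Subdifferentials, eigenvectors and gradient flows\<close>

text \<open>
  The subdifferential in its form for convex, absolutely one-homogeneous functionals on a
  closed subspace \<^term>\<open>H\<close>.
\<close>

definition subdiff :: "'a::real_inner set \<Rightarrow> ('a \<Rightarrow> ereal) \<Rightarrow> 'a \<Rightarrow> 'a set" where
  "subdiff H \<Phi> u = {p \<in> H. (\<forall>v\<in>H. ereal (p \<bullet> v) \<le> \<Phi> v) \<and> ereal (p \<bullet> u) = \<Phi> u}"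

definition dom_subdiff :: "'a::real_inner set \<Rightarrow> ('a \<Rightarrow> ereal) \<Rightarrow> 'a set" where
  "dom_subdiff H \<Phi> = {u \<in> H. subdiff H \<Phi> u \<noteq> {}}"

definition eigenvector :: "'a::real_inner set \<Rightarrow> ('a \<Rightarrow> ereal) \<Rightarrow> 'a \<Rightarrow> bool" where
  "eigenvector H \<Phi> u \<longleftrightarrow> u \<in> H \<and> (\<exists>l::real. l *\<^sub>R u \<in> subdiff H \<Phi> u)"

text \<open>
  The solution in the sense of Brezis: \<^term>\<open>- p t\<close> is the right derivative of \<^term>\<open>u\<close>
  at \<^term>\<open>t\<close> and \<^term>\<open>p t\<close> is the element of minimal norm of the subdifferential, for
  every positive \<^term>\<open>t\<close>. The values of \<^term>\<open>u\<close> at negative times and of \<^term>\<open>p\<close> at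
  nonpositive times are irrelevant.
\<close>

definition gradient_flow ::
  "'a::real_inner set \<Rightarrow> ('a \<Rightarrow> ereal) \<Rightarrow> 'a \<Rightarrow> (real \<Rightarrow> 'a) \<Rightarrow> (real \<Rightarrow> 'a) \<Rightarrow> bool" where
  "gradient_flow H \<Phi> f u p \<longleftrightarrow>
     u 0 = f \<and> (\<forall>t\<ge>0. u t \<in> H) \<and> continuous_on {0..} u \<and>
     (\<forall>\<delta>>0. \<exists>L. L-lipschitz_on {\<delta>..} u) \<and>
     (\<forall>t>0. u t \<in> dom_subdiff H \<Phi>) \<and>
     (\<forall>t>0. (u has_vector_derivative - p t) (at_right t)) \<and>
     (\<forall>t>0. p t \<in> subdiff H \<Phi> (u t) \<and> (\<forall>q\<in>subdiff H \<Phi> (u t). norm (p t) \<le> norm q))"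

end

theory Submission
  imports Defs
begin

text \<open>
  Write \<open>A\<close> and \<open>B\<close> for the sets of fields \<open>- grad v\<close> and \<open>perp_grad v\<close>, where \<open>v\<close> runs through the
  test functions with values in \<open>[-1, 1]\<close>. By definition \<open>J_div\<close> and \<open>J_rot\<close> are the support
  functions of \<open>A\<close> and \<open>B\<close>. Gradients of test functions are orthogonal to divergence-free fields
  and the members of \<open>B\<close> are divergence-free, so \<open>A\<close> and \<open>B\<close> are orthogonal convex sets.

  Fix a time \<open>t > 0\<close>. The flow enters through the fact that \<open>p = p t\<close> is the element of least norm in the
  subdifferential of \<open>J_sum\<close> at \<open>u = u t\<close>. The nearest point projection onto the closure of \<open>A + B\<close>
  shows that \<open>p\<close> lies in this closure, and orthogonality splits it as \<open>p = a + b\<close> with \<open>a\<close> and \<open>b\<close> in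
  the closures of \<open>A\<close> and \<open>B\<close> (\<open>subdiff_support_fun_sum_decompose\<close>). Both the pairing with \<open>u\<close> and
  the square of the norm are additive over such sums. Hence \<open>a\<close> maximises the pairing with \<open>u\<close> over
  the closure of \<open>A\<close>, and it has least norm among the maximisers; likewise \<open>b\<close> in the closure of \<open>B\<close>.

  The heart of the matter is that a maximiser \<open>a\<close> of least norm satisfies \<open>q \<bullet> a \<le> a \<bullet> a\<close> for all
  \<open>q\<close> in \<open>A\<close>: this says that \<open>J_div a = a \<bullet> a\<close>, so \<open>a\<close> is an eigenvector with eigenvalue 1. To see it,
  think of \<open>a = - grad v\<close> and \<open>q = - grad w\<close>, take \<open>0 < e < 1\<close>, and let \<open>z\<close> be the
  truncation of \<open>(1 + e) v - e w\<close> to the interval \<open>[-1, 1]\<close>. Truncation does not increase the length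
  of the gradient. Moreover the reflected function \<open>2 v - z\<close> still has values in \<open>[-1, 1]\<close>: since
  \<open>|w| \<le> 1\<close>, the step \<open>e (v - w)\<close> cannot be longer than the distance from \<open>v\<close> to the end of the
  interval that it leads away from. So \<open>v\<close> is the midpoint of two admissible potentials, and as \<open>a\<close>
  maximises a linear functional, \<open>- grad z\<close> is a maximiser as well. By minimality
  \<open>|a| \<le> |grad z| \<le> |(1 + e) a - e q|\<close>, and the terms of first order in \<open>e\<close> give the claim. The argument
  does not refer to the set where \<open>v = 1\<close> or \<open>v = -1\<close>, nor to the distribution \<open>div u\<close>. This makes it
  possible to stay with smooth potentials: \<open>v\<close> is replaced by an approximating sequence, truncation by
  a smooth function close to it (\<open>truncatable_gradient_fields\<close>), and the resulting almost maximisers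
  have a limit up to convex combinations (\<open>minimal_norm_maximizer_variational_inequality\<close>).

  By orthogonality \<open>J_sum p = J_div a + J_rot b = a \<bullet> a + b \<bullet> b = p \<bullet> p\<close>, so \<open>p\<close> is an
  eigenvector of the sum. Finally \<open>b\<close> is a limit of divergence-free test fields and \<open>a\<close> is orthogonal to
  all of them, so \<open>b\<close> is the Helmholtz projection of \<open>p\<close>.
\<close>

section \<open>Minimal norm elements of convex sets in Hilbert spaces\<close>

text \<open>
  The points of almost least norm in the sets form a Cauchy sequence, by the parallelogram law: their
  midpoints cannot be much shorter than they are. This gives nearest points of closed convex sets,
  and it also replaces weak compactness: with the convex hulls of the tails of a bounded sequence
  for \<open>C n\<close>, the point \<open>y\<close> inherits every closed convex constraint that the sequence satisfies eventually.
\<close>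

lemma decreasing_convex_sets_bounded_limit_point:
  fixes C :: "nat \<Rightarrow> 'a::{real_inner, complete_space} set" and x :: "nat \<Rightarrow> 'a"
  assumes conv: "\<And>n. convex (C n)" and dec: "\<And>n. C (Suc n) \<subseteq> C n"
    and x: "\<And>n. x n \<in> C n" and bd: "\<And>n. norm (x n) \<le> r n" and r: "r \<longlonglongrightarrow> R"
  obtains y where "\<And>n. y \<in> closure (C n)" "norm y \<le> R"
proof -
  have sub: "C m \<subseteq> C n" if "n \<le> m" for m n
    using lift_Suc_antimono_le[of C, OF dec that] .
  define d where "d n = Inf (norm ` C n)" for n
  have bdd: "bdd_below (norm ` C n)" for n
    by (auto intro: bdd_belowI[of _ 0])
  have d_le: "d n \<le> norm z" if "z \<in> C n" for n z
    unfolding d_def using that bdd by (auto intro: cInf_lower)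
  have d0: "0 \<le> d n" for n
    unfolding d_def using x[of n] by (intro cINF_greatest) auto
  have d_mono: "d n \<le> d m" if "n \<le> m" for m n
    unfolding d_def using x[of m] sub[OF that] bdd by (intro cInf_superset_mono) auto
  have dR: "d n \<le> R" for n
  proof (rule Lim_bounded2[OF r])
    show "\<forall>m\<ge>n. d n \<le> r m"
      using d_le x bd sub by (meson order_trans subsetD)
  qed
  have "\<exists>z\<in>C n. norm z < d n + inverse (real (Suc n))" for n
  proof -
    have "Inf (norm ` C n) < d n + inverse (real (Suc n))" by (simp add: d_def)
    then show ?thesis using x[of n] by (subst (asm) cInf_less_iff[OF _ bdd]) auto
  qed
  then obtain y where yC: "\<And>n. y n \<in> C n" and yn: "\<And>n. norm (y n) < d n + inverse (real (Suc n))"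
    by metis
  have conv_d: "convergent d"
    by (rule Bseq_mono_convergent[OF Bseq_eventually_mono[of d "\<lambda>_. R"]])
      (use d0 dR d_mono in \<open>auto intro!: always_eventually simp: abs_le_iff order_trans[OF d0 dR]\<close>)
  then obtain D where D: "d \<longlonglongrightarrow> D" by (auto simp: convergent_def)
  have dD: "d n \<le> D" for n
    using D d_mono by (meson LIMSEQ_le_const)
  have DR: "D \<le> R" using D dR by (meson LIMSEQ_le_const2)
  have yn2: "norm (y n) \<le> D + inverse (real (Suc n))" for n
    using yn[of n] dD[of n] by linarith
  \<comment> \<open>The bound that the parallelogram law gives for the squared distance of \<open>y n\<close> from later terms.\<close>
  define e where "e n = 4 * ((D + inverse (real (Suc n)))\<^sup>2 - (d n)\<^sup>2)" for n
  have key: "(norm (y n - y m))\<^sup>2 \<le> e n" if "n \<le> m" for n m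
  proof -
    have "y m \<in> C n" using yC sub[OF that] by auto
    then have "(1/2) *\<^sub>R y n + (1/2) *\<^sub>R y m \<in> C n"
      using convexD[OF conv yC[of n], of "y m" "1/2" "1/2"] by simp
    from d_le[OF this] have "2 * d n \<le> norm (y n + y m)"
      by (simp flip: scaleR_add_right)
    then have "(2 * d n)\<^sup>2 \<le> (norm (y n + y m))\<^sup>2" using d0[of n] by (intro power_mono) auto
    moreover have "(norm (y n))\<^sup>2 \<le> (D + inverse (real (Suc n)))\<^sup>2"
      using yn2[of n] by (intro power_mono) auto
    moreover have "norm (y m) \<le> D + inverse (real (Suc n))"
      using yn2[of m] that by (smt (verit) inverse_of_nat_le Suc_le_mono nat.distinct(1) of_nat_0_less_iff zero_less_Suc le_imp_inverse_le of_nat_mono)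
    then have "(norm (y m))\<^sup>2 \<le> (D + inverse (real (Suc n)))\<^sup>2"
      by (intro power_mono) auto
    moreover have "(norm (y n - y m))\<^sup>2 + (norm (y n + y m))\<^sup>2 = 2 * (norm (y n))\<^sup>2 + 2 * (norm (y m))\<^sup>2"
      by (simp add: power2_norm_eq_inner algebra_simps)
    ultimately show ?thesis by (simp add: e_def power_mult_distrib)
  qed
  have e0: "e \<longlonglongrightarrow> 0"
  proof -
    have "(\<lambda>n. 4 * ((D + inverse (real (Suc n)))\<^sup>2 - (d n)\<^sup>2)) \<longlonglongrightarrow> 4 * ((D + 0)\<^sup>2 - D\<^sup>2)"
      by (intro tendsto_intros D LIMSEQ_inverse_real_of_nat)
    then show ?thesis by (simp add: e_def[abs_def])
  qed
  have "Cauchy y"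
  proof (rule metric_CauchyI)
    fix \<epsilon> :: real assume "\<epsilon> > 0"
    then obtain N where N: "\<And>n. n \<ge> N \<Longrightarrow> e n < (\<epsilon>/2)\<^sup>2"
      using order_tendstoD(2)[OF e0, of "(\<epsilon>/2)\<^sup>2"] by (auto simp: eventually_sequentially)
    have "dist (y N) (y n) < \<epsilon>/2" if "n \<ge> N" for n
      using key[OF that] N[of N] \<open>\<epsilon> > 0\<close> 
      by (metis dist_norm half_gt_zero less_imp_le order.refl order_le_less_trans power_less_imp_less_base)
    then show "\<exists>M. \<forall>m\<ge>M. \<forall>n\<ge>M. dist (y m) (y n) < \<epsilon>"
      by (metis dist_commute dist_triangle_half_l)
  qed
  then obtain z where z: "y \<longlonglongrightarrow> z" by (auto simp: Cauchy_convergent_iff convergent_def)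
  show thesis
  proof
    show "z \<in> closure (C n)" for n
      unfolding closure_sequential
      by (rule exI[of _ "\<lambda>m. y (m + n)"]) (use yC subsetD[OF sub[OF le_add2]] LIMSEQ_ignore_initial_segment[OF z] in auto)
    have "norm z \<le> D + 0"
      by (rule LIMSEQ_le[OF tendsto_norm[OF z] tendsto_add[OF tendsto_const LIMSEQ_inverse_real_of_nat]]) (use yn2 in auto)
    then show "norm z \<le> R" using DR by simp
  qed
qed

text \<open>
  The nearest point \<open>y\<close> in the closure of \<open>C\<close>, characterised by its variational inequality.
\<close>

lemma closed_convex_nearest_point:
  fixes C :: "'a::{real_inner, complete_space} set"
  assumes "convex C" "C \<noteq> {}"
  obtains y where "y \<in> closure C" "\<And>c. c \<in> C \<Longrightarrow> (p - y) \<bullet> (c - y) \<le> 0"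
proof -
  define T where "T = (\<lambda>c. c - p) ` C"
  define R where "R = Inf (norm ` T)"
  have T: "convex T" "T \<noteq> {}"
    using assms convex_translation_subtract[of C p] by (auto simp: T_def)
  have bdd: "bdd_below (norm ` T)" by (auto intro: bdd_belowI[of _ 0])
  have "\<exists>z\<in>T. norm z < R + inverse (real (Suc n))" for n
  proof -
    have "Inf (norm ` T) < R + inverse (real (Suc n))" by (simp add: R_def)
    then show ?thesis using T by (subst (asm) cInf_less_iff[OF _ bdd]) auto
  qed
  then obtain x where "\<And>n. x n \<in> T" "\<And>n. norm (x n) \<le> R + inverse (real (Suc n))"
    by (metis less_imp_le)
  then obtain z where z: "z \<in> closure T" "norm z \<le> R"
    using decreasing_convex_sets_bounded_limit_point[of "\<lambda>_. T" x "\<lambda>n. R + inverse (real (Suc n))" R] T(1)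
      tendsto_add[OF tendsto_const[of R] LIMSEQ_inverse_real_of_nat] by auto
  have Rle: "R \<le> norm c" if "c \<in> closure T" for c
  proof -
    have "closure T \<subseteq> {c. R \<le> norm c}"
      by (rule closure_minimal) (auto simp: R_def bdd intro: cInf_lower intro!: closed_Collect_le continuous_intros)
    then show ?thesis using that by auto
  qed
  show thesis
  proof
    show "z + p \<in> closure C"
      using z(1) closure_translation_subtract[of p C] by (auto simp: T_def)
    fix c assume c: "c \<in> C"
    define w where "w = c - p - z"
    have min: "(norm z)\<^sup>2 \<le> (norm (z + s *\<^sub>R w))\<^sup>2" if "0 < s" "s \<le> 1" for s
    proof -
      have "c - p \<in> closure T" using c closure_subset by (fastforce simp: T_def)
      then have "(1 - s) *\<^sub>R z + s *\<^sub>R (c - p) \<in> closure T"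
        using convex_closure[OF T(1)] z that by (intro convexD_alt) auto
      then show ?thesis using Rle z by (force simp: w_def algebra_simps intro: power_mono)
    qed
    have "0 \<le> 2 * (z \<bullet> w) + s * (w \<bullet> w)" if "0 < s" "s \<le> 1" for s
    proof -
      have "0 \<le> s * (2 * (z \<bullet> w) + s * (w \<bullet> w))"
        using min[OF that] by (simp add: power2_norm_eq_inner algebra_simps inner_commute)
      then show ?thesis using that by (simp add: zero_le_mult_iff)
    qed
    then have "\<forall>\<^sub>F s in at_right 0. 0 \<le> 2 * (z \<bullet> w) + s * (w \<bullet> w)"
      by (intro eventually_at_rightI[of 0 1]) auto
    moreover have "((\<lambda>s. 2 * (z \<bullet> w) + s * (w \<bullet> w)) \<longlongrightarrow> 2 * (z \<bullet> w) + 0 * (w \<bullet> w)) (at_right 0)"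
      by (intro tendsto_intros)
    ultimately have "0 \<le> 2 * (z \<bullet> w) + 0 * (w \<bullet> w)"
      by (intro tendsto_lowerbound) auto
    then show "(p - (z + p)) \<bullet> (c - (z + p)) \<le> 0"
      by (simp add: w_def algebra_simps)
  qed
qed


text \<open>
  By the theorem of Pythagoras the two components of a Cauchy sequence of sums are Cauchy sequences.
\<close>

lemma closure_orthogonal_sum_decompose:
  fixes A B :: "'a::{real_inner, complete_space} set"
  assumes orth: "\<And>a b. a \<in> A \<Longrightarrow> b \<in> B \<Longrightarrow> a \<bullet> b = 0"
    and c: "c \<in> closure {a + b | a b. a \<in> A \<and> b \<in> B}"
  obtains a b where "a \<in> closure A" "b \<in> closure B" "c = a + b"
proof -
  obtain z where z: "\<And>n. z n \<in> {a + b | a b. a \<in> A \<and> b \<in> B}" "z \<longlonglongrightarrow> c"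
    using c unfolding closure_sequential by auto
  then have "\<forall>n. \<exists>a b. z n = a + b \<and> a \<in> A \<and> b \<in> B" by blast
  then obtain a b where ab: "\<And>n. z n = a n + b n" "\<And>n. a n \<in> A" "\<And>n. b n \<in> B" by metis
  have le: "dist (a m) (a n) \<le> dist (z m) (z n)" for m n
  proof -
    have "(norm (a m - a n))\<^sup>2 + (norm (b m - b n))\<^sup>2 = (norm (z m - z n))\<^sup>2"
      using orth ab by (simp add: power2_norm_eq_inner algebra_simps inner_commute)
    then have "(norm (a m - a n))\<^sup>2 \<le> (norm (z m - z n))\<^sup>2"
      by (metis le_add_same_cancel1 zero_le_power2)
    then show ?thesis by (simp add: dist_norm)
  qed
  have "Cauchy a"
    using LIMSEQ_imp_Cauchy[OF z(2)] le unfolding Cauchy_def by (meson order_le_less_trans)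
  then obtain a' where a': "a \<longlonglongrightarrow> a'" by (auto simp: Cauchy_convergent_iff convergent_def)
  have "(\<lambda>n. z n - a n) \<longlonglongrightarrow> c - a'" by (intro tendsto_intros z a')
  then have "b \<longlonglongrightarrow> c - a'" using ab(1) by (simp add: ab(1))
  then show thesis
    using that[of a' "c - a'"] a' ab(2,3) unfolding closure_sequential by auto
qed

text \<open>
  For small \<open>e\<close> the competitors \<open>x\<close> have a norm of at most about \<open>|(1 + e) a - e q|\<close> when \<open>v\<close> is close to
  \<open>a\<close>. They almost maximise the pairing with \<open>u\<close>, because \<open>v\<close> almost does and \<open>v\<close> is the midpoint of \<open>x\<close> and
  its reflection \<open>2 v - x\<close>, which belongs to \<open>A\<close> up to the factor \<open>1 + h\<close>. Hence there is a maximiser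
  of norm at most \<open>|(1 + e) a - e q|\<close>, and minimality of \<open>a\<close> yields the inequality to first order in \<open>e\<close>.
\<close>

lemma minimal_norm_maximizer_variational_inequality:
  fixes A :: "'a::{real_inner, complete_space} set"
  assumes conv: "convex A" and le: "\<And>x. x \<in> A \<Longrightarrow> x \<bullet> u \<le> S"
    and a: "a \<in> closure A" "a \<bullet> u = S"
    and min: "\<And>x. x \<in> closure A \<Longrightarrow> x \<bullet> u = S \<Longrightarrow> norm a \<le> norm x"
    and comp: "\<And>v e h. v \<in> A \<Longrightarrow> 0 < e \<Longrightarrow> e < 1 \<Longrightarrow> 0 < h \<Longrightarrow>
      \<exists>x\<in>A. norm x \<le> norm ((1 + e) *\<^sub>R v - e *\<^sub>R q) \<and> (1 / (1 + h)) *\<^sub>R (2 *\<^sub>R v - x) \<in> A"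
  shows "q \<bullet> a \<le> a \<bullet> a"
proof -
  obtain v where v: "\<And>n. v n \<in> A" "v \<longlonglongrightarrow> a"
    using a(1) unfolding closure_sequential by auto
  have le_cl: "x \<bullet> u \<le> S" if "x \<in> closure A" for x
    using closure_minimal[of A "{x. x \<bullet> u \<le> S}"] le that
    by (auto simp: closed_Collect_le continuous_on_inner continuous_on_const continuous_on_id)
  have step: "norm a \<le> norm ((1 + e) *\<^sub>R a - e *\<^sub>R q)" if e: "0 < e" "e < 1" for e
  proof -
    define h where "h n = inverse (real (Suc n))" for n
    have h: "h n > 0" for n by (simp add: h_def)
    have h0: "h \<longlonglongrightarrow> 0" unfolding h_def by (rule LIMSEQ_inverse_real_of_nat)
    obtain x where x: "\<And>n. x n \<in> A" and nx: "\<And>n. norm (x n) \<le> norm ((1 + e) *\<^sub>R v n - e *\<^sub>R q)"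
      and reflected: "\<And>n. (1 / (1 + h n)) *\<^sub>R (2 *\<^sub>R v n - x n) \<in> A"
    proof -
      have "\<forall>n. \<exists>x. x \<in> A \<and> norm x \<le> norm ((1 + e) *\<^sub>R v n - e *\<^sub>R q)
          \<and> (1 / (1 + h n)) *\<^sub>R (2 *\<^sub>R v n - x) \<in> A"
        using comp[OF v(1) e h] by blast
      from choice[OF this] that show thesis by blast
    qed
    define s where "s n = 2 * (v n \<bullet> u) - (1 + h n) * S" for n
    have s: "s n \<le> x n \<bullet> u" for n
    proof -
      have "(1 / (1 + h n)) * ((2 *\<^sub>R v n - x n) \<bullet> u) \<le> S"
        using le[OF reflected[of n]] by simp
      then show ?thesis using h[of n] by (simp add: s_def field_simps inner_diff_left)
    qed
    have "(\<lambda>n. 2 * (v n \<bullet> u) - (1 + h n) * S) \<longlonglongrightarrow> 2 * (a \<bullet> u) - (1 + 0) * S"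
      by (intro tendsto_intros v h0)
    then have s_lim: "s \<longlonglongrightarrow> S" by (simp add: s_def[abs_def] a)
    \<comment> \<open>Elements of \<open>C n\<close> pair with \<open>u\<close> to at least the infimum of \<open>s\<close> over \<open>{n..}\<close>, which tends to \<open>S\<close>.\<close>
    define C where "C n = convex hull (x ` {n..})" for n
    obtain y where y: "\<And>n. y \<in> closure (C n)" "norm y \<le> norm ((1 + e) *\<^sub>R a - e *\<^sub>R q)"
    proof (rule decreasing_convex_sets_bounded_limit_point[where C = C and x = x
          and r = "\<lambda>n. norm ((1 + e) *\<^sub>R v n - e *\<^sub>R q)"])
      show "C (Suc n) \<subseteq> C n" for n unfolding C_def by (intro hull_mono image_mono) auto
      show "x n \<in> C n" for n unfolding C_def by (intro hull_inc) auto
      show "(\<lambda>n. norm ((1 + e) *\<^sub>R v n - e *\<^sub>R q)) \<longlonglongrightarrow> norm ((1 + e) *\<^sub>R a - e *\<^sub>R q)"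
        by (intro tendsto_intros v)
    qed (auto simp: C_def nx)
    have yA: "y \<in> closure A"
      using y(1)[of 0] x conv closure_mono[of "C 0" A] hull_minimal[of "x ` {0..}" A convex]
      by (auto simp: C_def)
    have "S \<le> y \<bullet> u"
    proof (rule field_le_epsilon)
      fix d :: real assume "d > 0"
      then obtain N where N: "\<And>n. n \<ge> N \<Longrightarrow> S - d < s n"
        using order_tendstoD(1)[OF s_lim, of "S - d"] by (auto simp: eventually_sequentially)
      have "convex {z. S - d \<le> u \<bullet> z}" "closed {z. S - d \<le> u \<bullet> z}"
        using convex_halfspace_ge[of "S - d" u] closed_halfspace_ge[of "S - d" u] by auto
      moreover have "x ` {N..} \<subseteq> {z. S - d \<le> u \<bullet> z}"
        using N s by (force simp: inner_commute intro: less_imp_le order_less_le_trans)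
      ultimately have "closure (C N) \<subseteq> {z. S - d \<le> u \<bullet> z}"
        unfolding C_def by (intro closure_minimal hull_minimal)
      then show "S \<le> y \<bullet> u + d" using y(1)[of N] by (auto simp: inner_commute)
    qed
    then have "y \<bullet> u = S" using le_cl[OF yA] by simp
    then show ?thesis using min[OF yA] y(2) by linarith
  qed
  have "0 \<le> 2 * (a \<bullet> (a - q)) + e * ((a - q) \<bullet> (a - q))" if "0 < e" "e < 1" for e
  proof -
    have "(norm a)\<^sup>2 \<le> (norm ((1 + e) *\<^sub>R a - e *\<^sub>R q))\<^sup>2" using step[OF that] by (intro power_mono) auto
    then have "0 \<le> e * (2 * (a \<bullet> (a - q)) + e * ((a - q) \<bullet> (a - q)))"
      by (simp add: power2_norm_eq_inner algebra_simps inner_commute)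
    then show ?thesis using that by (simp add: zero_le_mult_iff)
  qed
  then have "\<forall>\<^sub>F e in at_right 0. 0 \<le> 2 * (a \<bullet> (a - q)) + e * ((a - q) \<bullet> (a - q))"
    by (intro eventually_at_rightI[of 0 1]) auto
  moreover have "((\<lambda>e. 2 * (a \<bullet> (a - q)) + e * ((a - q) \<bullet> (a - q))) \<longlongrightarrow>
      2 * (a \<bullet> (a - q)) + 0 * ((a - q) \<bullet> (a - q))) (at_right 0)"
    by (intro tendsto_intros)
  ultimately have "0 \<le> 2 * (a \<bullet> (a - q)) + 0 * ((a - q) \<bullet> (a - q))"
    by (intro tendsto_lowerbound) auto
  then show ?thesis by (simp add: inner_diff_right inner_commute)
qed

section \<open>Orthogonal sums of support functions\<close>

definition support_fun :: "'a::real_inner set \<Rightarrow> 'a \<Rightarrow> ereal" where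
  "support_fun A v = (SUP q\<in>A. ereal (q \<bullet> v))"

text \<open>
  The abstract form of truncating potentials: \<open>x\<close> stands for the field of the truncation of
  \<open>(1 + e) v - e q\<close>, and the last condition says that its reflection at \<open>v\<close> violates the constraint at
  most by the factor \<open>1 + h\<close>, where \<open>h\<close> bounds the error made by a smooth truncation.
\<close>

definition truncatable :: "'a::real_inner set \<Rightarrow> bool" where
  "truncatable A \<longleftrightarrow> (\<forall>q\<in>A. \<forall>v\<in>A. \<forall>e h. 0 < e \<longrightarrow> e < 1 \<longrightarrow> 0 < h \<longrightarrow>
     (\<exists>x\<in>A. norm x \<le> norm ((1 + e) *\<^sub>R v - e *\<^sub>R q) \<and> (1 / (1 + h)) *\<^sub>R (2 *\<^sub>R v - x) \<in> A))"

lemma inner_le_support_fun: "q \<in> A \<Longrightarrow> ereal (q \<bullet> v) \<le> support_fun A v"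
  unfolding support_fun_def by (rule SUP_upper)

lemma support_fun_least: "(\<And>q. q \<in> A \<Longrightarrow> ereal (q \<bullet> v) \<le> c) \<Longrightarrow> support_fun A v \<le> c"
  unfolding support_fun_def by (rule SUP_least)

lemma support_fun_nonneg: "0 \<in> A \<Longrightarrow> 0 \<le> support_fun A v"
  using inner_le_support_fun[of 0 A v] by (simp add: zero_ereal_def)

lemma closure_inner_le_support_fun:
  assumes "x \<in> closure A"
  shows "ereal (x \<bullet> v) \<le> support_fun A v"
proof -
  obtain y where y: "\<And>n. y n \<in> A" "y \<longlonglongrightarrow> x"
    using assms unfolding closure_sequential by auto
  have "(\<lambda>n. ereal (y n \<bullet> v)) \<longlonglongrightarrow> ereal (x \<bullet> v)"
    by (intro tendsto_ereal tendsto_inner y(2) tendsto_const)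
  then show ?thesis
    by (rule LIMSEQ_le_const2) (use inner_le_support_fun[OF y(1)] in blast)
qed

lemma closure_orthogonal:
  fixes A B :: "'a::real_inner set"
  assumes orth: "\<And>a b. a \<in> A \<Longrightarrow> b \<in> B \<Longrightarrow> a \<bullet> b = 0" and "x \<in> closure A" "y \<in> closure B"
  shows "x \<bullet> y = 0"
proof -
  have 1: "closure B \<subseteq> {z. a \<bullet> z = 0}" if "a \<in> A" for a
    by (rule closure_minimal[OF _ closed_hyperplane]) (use orth that in auto)
  have "closure A \<subseteq> {z. y \<bullet> z = 0}"
    by (rule closure_minimal[OF _ closed_hyperplane]) (use 1 assms(3) in \<open>auto simp: inner_commute\<close>)
  then show ?thesis using assms(2) by (auto simp: inner_commute)
qed

text \<open>
  Members of the closure of \<open>A\<close> are bounded by the support function; the assumption is the reverse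
  estimate.
\<close>

lemma support_fun_eq_square_norm:
  assumes "a \<in> closure A" "\<And>q. q \<in> A \<Longrightarrow> q \<bullet> a \<le> a \<bullet> a"
  shows "support_fun A a = ereal (a \<bullet> a)"
  using closure_inner_le_support_fun[OF assms(1), of a] support_fun_least[of A a "ereal (a \<bullet> a)"] assms(2)
  by (intro antisym) auto

lemma self_mem_subdiff:
  assumes "a \<in> H" "a \<in> closure A" "support_fun A a = ereal (a \<bullet> a)"
  shows "a \<in> subdiff H (support_fun A) a"
  using assms closure_inner_le_support_fun[OF assms(2)] by (auto simp: subdiff_def)

text \<open>
  A subgradient is dominated by the support function of \<open>A + B\<close>, so separation from its nearest
  point \<open>y\<close> in the closure of \<open>A + B\<close> is impossible. Splitting it by orthogonality, each component
  is at most the respective support function at \<open>u\<close>; as the sums agree, so do the summands.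
\<close>

lemma subdiff_support_fun_sum_decompose:
  fixes A B H :: "'a::{real_inner, complete_space} set"
  assumes H: "subspace H" "closed H" and AH: "A \<subseteq> H" "B \<subseteq> H"
    and conv: "convex A" "convex B" and zero: "0 \<in> A" "0 \<in> B"
    and orth: "\<And>a b. a \<in> A \<Longrightarrow> b \<in> B \<Longrightarrow> a \<bullet> b = 0"
    and p: "p \<in> subdiff H (\<lambda>v. support_fun A v + support_fun B v) u" and u: "u \<in> H"
  obtains a b where "a \<in> closure A" "b \<in> closure B" "p = a + b"
    "support_fun A u = ereal (a \<bullet> u)" "support_fun B u = ereal (b \<bullet> u)"
proof -
  define C where "C = {a + b | a b. a \<in> A \<and> b \<in> B}"
  have C: "convex C" "C \<noteq> {}"
  proof -
    have "C = (\<Union>x\<in>A. \<Union>y\<in>B. {x + y})" unfolding C_def by blast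
    then show "convex C" using convex_sums[OF conv] by simp
    show "C \<noteq> {}" using zero unfolding C_def by blast
  qed
  obtain y where y: "y \<in> closure C" "\<And>c. c \<in> C \<Longrightarrow> (p - y) \<bullet> (c - y) \<le> 0"
    by (rule closed_convex_nearest_point[OF C, of p]) blast
  have "C \<subseteq> H" unfolding C_def using AH subspace_add[OF H(1)] by blast
  then have yH: "y \<in> H" using closure_minimal[OF _ H(2)] y(1) by blast
  have pH: "p \<in> H" and p_le: "\<And>v. v \<in> H \<Longrightarrow> ereal (p \<bullet> v) \<le> support_fun A v + support_fun B v"
    and pu: "ereal (p \<bullet> u) = support_fun A u + support_fun B u"
    using p by (auto simp: subdiff_def)
  define v where "v = p - y"
  have ab: "a \<bullet> v + b \<bullet> v \<le> y \<bullet> v" if "a \<in> A" "b \<in> B" for a b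
  proof -
    have "a + b \<in> C" using that unfolding C_def by blast
    from y(2)[OF this] show ?thesis
      by (simp add: v_def[symmetric] inner_diff_right inner_add_right inner_commute)
  qed
  have "support_fun A v + support_fun B v \<le> ereal (y \<bullet> v)"
  proof -
    \<comment> \<open>Taking the supremum over \<open>A\<close> first shows that it is finite, so it may be subtracted.\<close>
    have "support_fun A v \<le> ereal (y \<bullet> v - b \<bullet> v)" if "b \<in> B" for b
      by (rule support_fun_least) (use ab that in \<open>simp add: le_diff_eq\<close>)
    note A_le = this
    have "support_fun A v \<le> ereal (y \<bullet> v)" using A_le[OF zero(2)] by simp
    then obtain s where s: "support_fun A v = ereal s"
      using support_fun_nonneg[OF zero(1), of v] by (cases "support_fun A v") auto
    have "support_fun B v \<le> ereal (y \<bullet> v - s)"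
      by (rule support_fun_least) (use A_le s in \<open>force simp: le_diff_eq add.commute\<close>)
    then have "ereal s + support_fun B v \<le> ereal s + ereal (y \<bullet> v - s)" by (rule add_left_mono)
    then show ?thesis using s by simp
  qed
  moreover have "v \<in> H" unfolding v_def by (rule subspace_diff[OF H(1) pH yH])
  ultimately have "p \<bullet> v \<le> y \<bullet> v" using p_le[of v] order_trans by fastforce
  then have "v \<bullet> v \<le> 0" by (simp add: v_def inner_diff_left)
  then have "v \<bullet> v = 0" using inner_ge_zero[of v] by linarith
  then have "p = y" unfolding inner_eq_zero_iff by (simp add: v_def)
  then obtain a b where d: "a \<in> closure A" "b \<in> closure B" "p = a + b"
    using closure_orthogonal_sum_decompose[OF orth, of A B p] y(1) unfolding C_def by blast
  have le: "ereal (a \<bullet> u) \<le> support_fun A u" "ereal (b \<bullet> u) \<le> support_fun B u"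
    by (rule closure_inner_le_support_fun, fact)+
  have "support_fun A u + support_fun B u = ereal (a \<bullet> u + b \<bullet> u)"
    using pu d(3) by (simp add: inner_add_left)
  then have "support_fun A u = ereal (a \<bullet> u) \<and> support_fun B u = ereal (b \<bullet> u)"
    using le by (cases "support_fun A u"; cases "support_fun B u") auto
  then show thesis using that d by blast
qed

text \<open>
  Exchanging \<open>a\<close> for another maximiser \<open>x\<close> in the closure of \<open>A\<close> leaves a subgradient \<open>x + b\<close>, and \<open>b\<close> is
  orthogonal to both. So the minimality of \<open>a + b\<close> is inherited by \<open>a\<close>.
\<close>

lemma minimal_subgradient_component_dual_norm:
  fixes A B H :: "'a::{real_inner, complete_space} set"
  assumes H: "subspace H" "closed H" and AH: "A \<subseteq> H" "B \<subseteq> H" and conv: "convex A"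
    and orth: "\<And>a b. a \<in> A \<Longrightarrow> b \<in> B \<Longrightarrow> a \<bullet> b = 0" and trunc: "truncatable A"
    and a: "a \<in> closure A" "support_fun A u = ereal (a \<bullet> u)"
    and b: "b \<in> closure B" "support_fun B u = ereal (b \<bullet> u)"
    and min: "\<And>q. q \<in> subdiff H (\<lambda>v. support_fun A v + support_fun B v) u \<Longrightarrow> norm (a + b) \<le> norm q"
  shows "support_fun A a = ereal (a \<bullet> a)"
proof (rule support_fun_eq_square_norm[OF a(1)])
  fix q assume q: "q \<in> A"
  have clH: "closure A \<subseteq> H" "closure B \<subseteq> H" using closure_minimal[OF _ H(2)] AH by blast+
  show "q \<bullet> a \<le> a \<bullet> a"
  proof (rule minimal_norm_maximizer_variational_inequality[OF conv _ a(1) refl])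
    show "x \<bullet> u \<le> a \<bullet> u" if "x \<in> A" for x
      using inner_le_support_fun[OF that, of u] a(2) by simp
    show "norm a \<le> norm x" if x: "x \<in> closure A" "x \<bullet> u = a \<bullet> u" for x
    proof -
      have "x + b \<in> subdiff H (\<lambda>v. support_fun A v + support_fun B v) u"
        unfolding subdiff_def
      proof (intro CollectI conjI ballI)
        show "x + b \<in> H" using clH x(1) b(1) subspace_add[OF H(1)] by blast
        show "ereal ((x + b) \<bullet> v) \<le> support_fun A v + support_fun B v" for v
          using add_mono[OF closure_inner_le_support_fun[OF x(1), of v] closure_inner_le_support_fun[OF b(1), of v]]
          by (simp add: inner_add_left)
        show "ereal ((x + b) \<bullet> u) = support_fun A u + support_fun B u"
          using a(2) b(2) x(2) by (simp add: inner_add_left)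
      qed
      from min[OF this] have "(norm (a + b))\<^sup>2 \<le> (norm (x + b))\<^sup>2" by (intro power_mono) auto
      moreover have "a \<bullet> b = 0" "x \<bullet> b = 0"
        using closure_orthogonal[OF orth _ b(1), of A] a(1) x(1) by blast+
      ultimately have "(norm a)\<^sup>2 \<le> (norm x)\<^sup>2"
        by (simp add: power2_norm_eq_inner inner_add_left inner_add_right inner_commute)
      then show ?thesis by simp
    qed
    show "\<exists>x\<in>A. norm x \<le> norm ((1 + e) *\<^sub>R v - e *\<^sub>R q) \<and> (1 / (1 + h)) *\<^sub>R (2 *\<^sub>R v - x) \<in> A"
      if "v \<in> A" "0 < e" "e < 1" "0 < h" for v e h
      using trunc q that unfolding truncatable_def by blast
  qed
qed

text \<open>
  The support function of \<open>A\<close> does not see the component \<open>b\<close>, nor that of \<open>B\<close> the component \<open>a\<close>.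
  Thus the values at \<open>p\<close> are the square norms of \<open>a\<close> and \<open>b\<close>, which add up to \<open>p \<bullet> p\<close>.
\<close>

lemma minimal_subgradient_orthogonal_eigenvectors:
  fixes A B H :: "'a::{real_inner, complete_space} set"
  assumes H: "subspace H" "closed H" and AH: "A \<subseteq> H" "B \<subseteq> H"
    and conv: "convex A" "convex B" and zero: "0 \<in> A" "0 \<in> B"
    and orth: "\<And>a b. a \<in> A \<Longrightarrow> b \<in> B \<Longrightarrow> a \<bullet> b = 0" and trunc: "truncatable A" "truncatable B"
    and p: "p \<in> subdiff H (\<lambda>v. support_fun A v + support_fun B v) u" and u: "u \<in> H"
    and min: "\<And>q. q \<in> subdiff H (\<lambda>v. support_fun A v + support_fun B v) u \<Longrightarrow> norm p \<le> norm q"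
  obtains a b where "a \<in> closure A" "b \<in> closure B" "p = a + b"
    "a \<in> subdiff H (support_fun A) a" "b \<in> subdiff H (support_fun B) b"
    "p \<in> subdiff H (\<lambda>v. support_fun A v + support_fun B v) p"
proof -
  obtain a b where d: "a \<in> closure A" "b \<in> closure B" "p = a + b"
    "support_fun A u = ereal (a \<bullet> u)" "support_fun B u = ereal (b \<bullet> u)"
    by (rule subdiff_support_fun_sum_decompose[OF H AH conv zero orth p u])
  have a: "support_fun A a = ereal (a \<bullet> a)"
    by (rule minimal_subgradient_component_dual_norm[OF H AH conv(1) orth trunc(1) d(1,4,2,5)])
      (use min d(3) in auto)
  have orth': "y \<bullet> x = 0" if "y \<in> B" "x \<in> A" for x y using orth[OF that(2,1)] by (simp add: inner_commute)
  have b: "support_fun B b = ereal (b \<bullet> b)"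
    by (rule minimal_subgradient_component_dual_norm[OF H AH(2,1) conv(2) orth' trunc(2) d(2,5,1,4)])
      (use min d(3) in \<open>auto simp: add.commute\<close>)
  have clH: "closure A \<subseteq> H" "closure B \<subseteq> H" using closure_minimal[OF _ H(2)] AH by blast+
  have ab: "a \<bullet> b = 0" by (rule closure_orthogonal[OF orth d(1,2)])
  have "support_fun A p = support_fun A a"
    unfolding support_fun_def d(3)
    by (rule SUP_cong) (use closure_orthogonal[OF orth _ d(2)] closure_subset in \<open>auto simp: inner_add_right\<close>)
  moreover have "support_fun B p = support_fun B b"
    unfolding support_fun_def d(3)
    by (rule SUP_cong) (use closure_orthogonal[OF orth' _ d(1)] closure_subset in \<open>auto simp: inner_add_right\<close>)
  ultimately have "ereal (p \<bullet> p) = support_fun A p + support_fun B p"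
    using a b ab by (simp add: d(3) inner_add_left inner_add_right inner_commute)
  then have "p \<in> subdiff H (\<lambda>v. support_fun A v + support_fun B v) p"
    using p by (simp add: subdiff_def)
  then show thesis
    using that[OF d(1,2,3)] self_mem_subdiff[OF _ d(1) a] self_mem_subdiff[OF _ d(2) b] clH d(1,2) by blast
qed

section \<open>Calculus of smooth functions on the plane\<close>

lemma partial_eqI:
  assumes "(v has_derivative v') (at x)"
  shows "partial i v x = v' (axis i 1)"
  using frechet_derivative_at[OF assms] by (simp add: partial_def)

lemma has_derivative_partial:
  assumes "v differentiable (at x)"
  shows "((\<lambda>t. v (x + t *\<^sub>R axis i 1)) has_real_derivative partial i v x) (at 0)"
proof -
  have "(v has_derivative frechet_derivative v (at x)) (at (x + 0 *\<^sub>R axis i 1))"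
    using assms frechet_derivative_works by auto
  moreover have "((\<lambda>t. x + t *\<^sub>R axis i 1) has_derivative (\<lambda>t. t *\<^sub>R axis i 1)) (at (0::real))"
    by (auto intro!: derivative_eq_intros)
  ultimately have "((\<lambda>t. v (x + t *\<^sub>R axis i 1)) has_derivative (\<lambda>t. frechet_derivative v (at x) (t *\<^sub>R axis i 1))) (at 0)"
    by (rule has_derivative_compose[rotated])
  moreover have "linear (frechet_derivative v (at x))"
    using assms linear_frechet_derivative by blast
  ultimately show ?thesis
    by (simp add: has_field_derivative_def partial_def linear_cmul mult_commute_abs)
qed

lemma partial_line_has_derivative:
  assumes "\<And>x. v differentiable (at x)"
  shows "((\<lambda>t. v (x + t *\<^sub>R axis i 1)) has_real_derivative partial i v (x + t *\<^sub>R axis i 1)) (at t)"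
proof -
  have "((\<lambda>s. v (x + t *\<^sub>R axis i 1 + s *\<^sub>R axis i 1)) has_real_derivative partial i v (x + t *\<^sub>R axis i 1)) (at 0)"
    by (rule has_derivative_partial[OF assms])
  then show ?thesis
    using DERIV_shift[of "\<lambda>t. v (x + t *\<^sub>R axis i 1)" _ 0 t]
    by (simp add: algebra_simps)
qed

lemma partial_mean_value:
  assumes "\<And>x. v differentiable (at x)" "h > 0"
  obtains \<theta> where "0 < \<theta>" "\<theta> < h" "v (x + h *\<^sub>R axis i 1) - v x = h * partial i v (x + \<theta> *\<^sub>R axis i 1)"
  using MVT2[OF assms(2) partial_line_has_derivative[OF assms(1)], of x i] by auto

lemma Ck_imp_continuous: "Ck k v \<Longrightarrow> continuous_on UNIV v"
  by (cases k) (auto simp: differentiable_imp_continuous_on differentiable_on_def differentiable_at_withinI)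

lemma Ck_SucD: "Ck (Suc k) v \<Longrightarrow> Ck k v"
proof (induction k arbitrary: v)
  case 0
  then show ?case using Ck_imp_continuous[of 1 v] by simp
qed auto

lemma Ck_const: "Ck k (\<lambda>x. c)"
proof (induction k arbitrary: c)
  case (Suc k)
  have "partial i (\<lambda>x. c) = (\<lambda>x. 0)" for i
    by (rule ext) (simp add: partial_eqI[OF has_derivative_const])
  then show ?case using Suc by simp
qed simp

lemma partial_add:
  assumes "v differentiable (at x)" "w differentiable (at x)"
  shows "partial i (\<lambda>x. v x + w x) x = partial i v x + partial i w x"
  using partial_eqI[OF has_derivative_add[OF assms[unfolded frechet_derivative_works]]]
  by (simp add: partial_def)

lemma partial_mult:
  assumes "v differentiable (at x)" "w differentiable (at x)"
  shows "partial i (\<lambda>x. v x * w x) x = v x * partial i w x + partial i v x * w x"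
  using partial_eqI[OF has_derivative_mult[OF assms[unfolded frechet_derivative_works]]]
  by (simp add: partial_def)

lemma partial_compose:
  assumes "v differentiable (at x)" "(F has_real_derivative F') (at (v x))"
  shows "partial i (\<lambda>x. F (v x)) x = F' * partial i v x"
  using partial_eqI[OF has_derivative_compose[OF assms(1)[unfolded frechet_derivative_works]
     assms(2)[unfolded has_field_derivative_def]]]
  by (simp add: partial_def)

lemma Ck_add: "Ck k v \<Longrightarrow> Ck k w \<Longrightarrow> Ck k (\<lambda>x. v x + w x)"
proof (induction k arbitrary: v w)
  case (Suc k)
  then have "partial i (\<lambda>x. v x + w x) = (\<lambda>x. partial i v x + partial i w x)" for i
    by (auto intro!: partial_add)
  then show ?case using Suc by (auto intro!: differentiable_add)
qed (auto intro: continuous_intros)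

lemma Ck_mult: "Ck k v \<Longrightarrow> Ck k w \<Longrightarrow> Ck k (\<lambda>x. v x * w x)"
proof (induction k arbitrary: v w)
  case (Suc k)
  then have "partial i (\<lambda>x. v x * w x) = (\<lambda>x. v x * partial i w x + partial i v x * w x)" for i
    by (auto intro!: partial_mult)
  moreover have "Ck k v" "Ck k w" using Suc.prems Ck_SucD by blast+
  ultimately show ?case using Suc by (auto intro!: differentiable_mult Ck_add)
qed (auto intro: continuous_intros)

text \<open>
  The exponent is arbitrary since differentiation lowers it by one.
\<close>

lemma Ck_powr: "Ck k v \<Longrightarrow> (\<And>x. v x > 0) \<Longrightarrow> Ck k (\<lambda>x. v x powr r)"
proof (induction k arbitrary: v r)
  case 0
  then show ?case by (auto intro!: continuous_intros simp: less_imp_neq[THEN not_sym])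
next
  case (Suc k)
  have diff: "v differentiable (at x)" for x using Suc by simp
  have der: "((\<lambda>z. z powr r) has_real_derivative r * v x powr (r - 1)) (at (v x))" for x
    using Suc.prems by (intro has_real_derivative_powr)
  have "partial i (\<lambda>x. v x powr r) = (\<lambda>x. (r * v x powr (r - 1)) * partial i v x)" for i
    using partial_compose[OF diff der] by blast
  moreover have "Ck k v" using Suc.prems Ck_SucD by blast
  moreover have "(\<lambda>x. v x powr r) differentiable (at x)" for x
    using has_derivative_compose[OF diff[unfolded frechet_derivative_works] der[unfolded has_field_derivative_def]]
    by (auto simp: differentiable_def)
  ultimately show ?case using Suc by (auto intro!: Ck_mult Ck_const)
qed

lemma smooth_const: "smooth (\<lambda>x. c)"
  and smooth_add: "smooth v \<Longrightarrow> smooth w \<Longrightarrow> smooth (\<lambda>x. v x + w x)"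
  and smooth_mult: "smooth v \<Longrightarrow> smooth w \<Longrightarrow> smooth (\<lambda>x. v x * w x)"
  and smooth_powr: "smooth v \<Longrightarrow> (\<And>x. v x > 0) \<Longrightarrow> smooth (\<lambda>x. v x powr r)"
  by (auto simp: smooth_def Ck_const Ck_add Ck_mult Ck_powr)

lemma smooth_cmult: "smooth v \<Longrightarrow> smooth (\<lambda>x. c * v x)"
  by (intro smooth_mult smooth_const)

lemma smooth_differentiable: "smooth v \<Longrightarrow> v differentiable (at x)"
  and smooth_partial: "smooth v \<Longrightarrow> smooth (partial i v)"
  by (meson Ck.simps smooth_def)+

lemma smooth_continuous: "smooth v \<Longrightarrow> continuous_on UNIV v"
  using Ck_imp_continuous by (auto simp: smooth_def)

lemma partial_cmult: "smooth v \<Longrightarrow> partial i (\<lambda>x. c * v x) x = c * partial i v x"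
  using partial_mult[of "\<lambda>_. c" x v i]
  by (simp add: smooth_differentiable partial_eqI[OF has_derivative_const])

lemma partial_difference:
  assumes "smooth v"
  shows "partial i (\<lambda>x. v (x + a) - v x) x = partial i v (x + a) - partial i v x"
proof -
  have "((\<lambda>x. v (x + a)) has_derivative (\<lambda>h. frechet_derivative v (at (x + a)) h)) (at x)"
    by (rule has_derivative_compose[of "\<lambda>x. x + a" "\<lambda>h. h"])
      (auto intro!: derivative_eq_intros simp: smooth_differentiable[OF assms] simp flip: frechet_derivative_works)
  moreover have "(v has_derivative (\<lambda>h. frechet_derivative v (at x) h)) (at x)"
    using smooth_differentiable[OF assms] by (simp flip: frechet_derivative_works)
  ultimately show ?thesis
    by (subst partial_eqI[OF has_derivative_diff]) (auto simp: partial_def)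
qed

text \<open>
  The second difference of \<open>v\<close> over a square with sides parallel to two axes is symmetric in the
  axes. Two applications of the mean value theorem express it, in either order, by a mixed partial
  derivative at a nearby point; continuity of these derivatives finishes the argument.
\<close>

lemma partial_commute:
  assumes v: "smooth v"
  shows "partial i (partial j v) x = partial j (partial i v) x"
proof -
  have mv: "\<exists>y. dist y x \<le> 2 * h \<and>
      v (x + h *\<^sub>R axis i 1 + h *\<^sub>R axis j 1) - v (x + h *\<^sub>R axis i 1) - v (x + h *\<^sub>R axis j 1) + v x
        = h * h * partial j (partial i v) y" if h: "h > 0" for h :: real and i j :: 2
  proof -
    define g where "g = (\<lambda>x. v (x + h *\<^sub>R axis j 1) - v x)"
    have g: "g differentiable (at x)" for x
      unfolding g_def using smooth_differentiable[OF v]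
      by (intro differentiable_diff differentiable_compose[of v "\<lambda>x. x + h *\<^sub>R axis j 1"]
          differentiable_add differentiable_ident differentiable_const)
    obtain s where s: "0 < s" "s < h" "g (x + h *\<^sub>R axis i 1) - g x = h * partial i g (x + s *\<^sub>R axis i 1)"
      by (rule partial_mean_value[OF g h])
    obtain t where t: "0 < t" "t < h" "partial i v (x + s *\<^sub>R axis i 1 + h *\<^sub>R axis j 1) - partial i v (x + s *\<^sub>R axis i 1)
        = h * partial j (partial i v) (x + s *\<^sub>R axis i 1 + t *\<^sub>R axis j 1)"
      by (rule partial_mean_value[OF smooth_differentiable[OF smooth_partial[OF v]] h])
    have "dist (x + s *\<^sub>R axis i 1 + t *\<^sub>R axis j 1) x \<le> norm (s *\<^sub>R axis i 1 :: real^2) + norm (t *\<^sub>R axis j 1 :: real^2)"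
      unfolding dist_norm by (metis add.assoc add_diff_cancel_left' norm_triangle_ineq)
    also have "\<dots> \<le> 2 * h" using s t by (simp add: norm_axis_1)
    finally have "dist (x + s *\<^sub>R axis i 1 + t *\<^sub>R axis j 1) x \<le> 2 * h" .
    moreover have "v (x + h *\<^sub>R axis i 1 + h *\<^sub>R axis j 1) - v (x + h *\<^sub>R axis i 1) - v (x + h *\<^sub>R axis j 1) + v x
        = h * h * partial j (partial i v) (x + s *\<^sub>R axis i 1 + t *\<^sub>R axis j 1)"
      using s(3) t(3) unfolding g_def partial_difference[OF v] by simp
    ultimately show ?thesis by blast
  qed
  define h where "h n = inverse (real (Suc n))" for n
  have h: "h n > 0" for n by (simp add: h_def)
  have h0: "(\<lambda>n. 2 * h n) \<longlonglongrightarrow> 0"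
    unfolding h_def by (rule tendsto_mult_right_zero[OF LIMSEQ_inverse_real_of_nat])
  have "\<exists>y. \<forall>n. dist (y n) x \<le> 2 * h n \<and>
      v (x + h n *\<^sub>R axis i 1 + h n *\<^sub>R axis j 1) - v (x + h n *\<^sub>R axis i 1) - v (x + h n *\<^sub>R axis j 1) + v x
        = h n * h n * partial j (partial i v) (y n)"
    by (intro choice allI mv h)
  then obtain y where y: "\<And>n. dist (y n) x \<le> 2 * h n" 
    "\<And>n. v (x + h n *\<^sub>R axis i 1 + h n *\<^sub>R axis j 1) - v (x + h n *\<^sub>R axis i 1) - v (x + h n *\<^sub>R axis j 1) + v x
        = h n * h n * partial j (partial i v) (y n)" by blast
  have "\<exists>y. \<forall>n. dist (y n) x \<le> 2 * h n \<and>
      v (x + h n *\<^sub>R axis j 1 + h n *\<^sub>R axis i 1) - v (x + h n *\<^sub>R axis j 1) - v (x + h n *\<^sub>R axis i 1) + v x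
        = h n * h n * partial i (partial j v) (y n)"
    by (intro choice allI mv h)
  then obtain z where z: "\<And>n. dist (z n) x \<le> 2 * h n" 
    "\<And>n. v (x + h n *\<^sub>R axis j 1 + h n *\<^sub>R axis i 1) - v (x + h n *\<^sub>R axis j 1) - v (x + h n *\<^sub>R axis i 1) + v x
        = h n * h n * partial i (partial j v) (z n)" by blast
  have swap: "x + h n *\<^sub>R axis j 1 + h n *\<^sub>R axis i 1 = x + h n *\<^sub>R axis i 1 + h n *\<^sub>R axis j 1" for n
    by (simp add: add_ac)
  have eq: "partial j (partial i v) (y n) = partial i (partial j v) (z n)" for n
  proof -
    have "h n * h n * partial j (partial i v) (y n) = h n * h n * partial i (partial j v) (z n)"
      using y(2)[of n] z(2)[of n] unfolding swap by linarith
    then show ?thesis using h[of n] by simp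
  qed
  have lim: "(\<lambda>n. partial a (partial b v) (y n)) \<longlonglongrightarrow> partial a (partial b v) x"
    if "\<And>n. dist (y n) x \<le> 2 * h n" for y a b
  proof -
    have "isCont (partial a (partial b v)) x"
      using smooth_continuous[OF smooth_partial[OF smooth_partial[OF v]]]
      by (simp add: continuous_on_eq_continuous_at)
    moreover have "y \<longlonglongrightarrow> x"
      unfolding tendsto_dist_iff[of y]
      by (rule tendsto_sandwich[OF _ _ tendsto_const h0]) (use that in auto)
    ultimately show ?thesis by (rule isCont_tendsto_compose)
  qed
  have "(\<lambda>n. partial j (partial i v) (y n)) \<longlonglongrightarrow> partial j (partial i v) x"
    by (rule lim) (rule y(1))
  moreover have "(\<lambda>n. partial j (partial i v) (y n)) = (\<lambda>n. partial i (partial j v) (z n))"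
    by (rule ext) (rule eq)
  ultimately have ji: "(\<lambda>n. partial i (partial j v) (z n)) \<longlonglongrightarrow> partial j (partial i v) x"
    by (simp only:)
  have ij: "(\<lambda>n. partial i (partial j v) (z n)) \<longlonglongrightarrow> partial i (partial j v) x"
    by (rule lim) (rule z(1))
  show ?thesis by (rule LIMSEQ_unique[OF ij ji])
qed

section \<open>The Hilbert space of square-integrable fields\<close>

lemma sq_integrable_rep: "sq_integrable (rep_L2 u)"
  using Quotient3_rep_reflp[OF Quotient3_L2, of u] by (simp add: L2_eq_def)

lemma abs_rep_L2: "abs_L2 (rep_L2 u) = u"
  using Quotient3_abs_rep[OF Quotient3_L2] .

lemma rep_abs_L2_AE:
  assumes "sq_integrable f"
  shows "AE x in lebesgue. rep_L2 (abs_L2 f) x = f x"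
  using rep_abs_rsp_left[OF Quotient3_L2, of f f] assms by (simp add: L2_eq_def)

lemma abs_L2_add: "sq_integrable f \<Longrightarrow> sq_integrable g \<Longrightarrow> abs_L2 f + abs_L2 g = abs_L2 (\<lambda>x. f x + g x)"
  by (simp add: plus_L2.abs_eq L2_eq_def)

lemma abs_L2_scaleR: "sq_integrable f \<Longrightarrow> c *\<^sub>R abs_L2 f = abs_L2 (\<lambda>x. c *\<^sub>R f x)"
  by (simp add: scaleR_L2.abs_eq L2_eq_def)

lemma sq_integrable_diff: "sq_integrable f \<Longrightarrow> sq_integrable g \<Longrightarrow> sq_integrable (\<lambda>x. f x - g x)"
  using sq_integrable_add[OF _ sq_integrable_scaleR[of g "-1"], of f] by simp

lemma abs_L2_diff: "sq_integrable f \<Longrightarrow> sq_integrable g \<Longrightarrow> abs_L2 f - abs_L2 g = abs_L2 (\<lambda>x. f x - g x)"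
  using abs_L2_add[OF _ sq_integrable_scaleR[of g "-1"], of f] abs_L2_scaleR[of g "-1"]
  by (simp add: diff_conv_add_uminus del: add_uminus_conv_diff)

lemma abs_L2_inner: "sq_integrable f \<Longrightarrow> sq_integrable g \<Longrightarrow> abs_L2 f \<bullet> abs_L2 g = (LINT x|lebesgue. f x \<bullet> g x)"
  by (simp add: inner_L2.abs_eq L2_eq_def)

lemma abs_L2_norm: "sq_integrable f \<Longrightarrow> (norm (abs_L2 f))\<^sup>2 = (LINT x|lebesgue. (norm (f x))\<^sup>2)"
  by (simp add: power2_norm_eq_inner abs_L2_inner)

lemma L2_inner_abs: "sq_integrable f \<Longrightarrow> u \<bullet> abs_L2 f = (LINT x|lebesgue. rep_L2 u x \<bullet> f x)"
  using abs_L2_inner[OF sq_integrable_rep, of f u] by (simp add: abs_rep_L2)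

lemma L2_norm_diff: "(norm (u - v))\<^sup>2 = (LINT x|lebesgue. (norm (rep_L2 u x - rep_L2 v x))\<^sup>2)"
  using abs_L2_norm[OF sq_integrable_diff[OF sq_integrable_rep sq_integrable_rep], of u v]
    abs_L2_diff[OF sq_integrable_rep sq_integrable_rep, of u v]
  by (simp add: abs_rep_L2)

lemma L2_nn_integral_diff:
  "(\<integral>\<^sup>+x. ennreal ((norm (rep_L2 u x - rep_L2 v x))\<^sup>2) \<partial>lebesgue) = ennreal ((norm (u - v))\<^sup>2)"
  unfolding L2_norm_diff
  by (intro nn_integral_eq_integral) (use sq_integrable_diff[OF sq_integrable_rep sq_integrable_rep] in \<open>auto simp: sq_integrable_def\<close>)

lemma rep_L2_measurable [measurable]: "rep_L2 u \<in> borel_measurable lebesgue"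
  using sq_integrable_rep by (simp add: sq_integrable_def)

lemma quarter_power: "(1/4 :: real) ^ n = ((1/2) ^ n)\<^sup>2"
  by (induction n) (auto simp: power2_eq_square)

text \<open>
  The terms of the series are bounded, so the increments of \<open>f\<close> decay like \<open>(1 / sqrt 2) ^ n\<close>.
\<close>

lemma weighted_square_summable_imp_convergent:
  fixes f :: "nat \<Rightarrow> 'a::banach"
  assumes "(\<Sum>n. ennreal (2 ^ n * (norm (f (Suc n) - f n))\<^sup>2)) \<noteq> \<infinity>"
  shows "convergent f"
proof -
  define a where "a n = 2 ^ n * (norm (f (Suc n) - f n))\<^sup>2" for n
  have a0: "0 \<le> a n" for n by (simp add: a_def)
  have "summable a"
    using assms a0 unfolding infinity_ennreal_def a_def[symmetric] by (intro summable_suminf_not_top)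
  then have "Bseq a" by (rule summable_imp_Bseq)
  then obtain M where "\<And>n. norm (a n) \<le> M" by (meson BseqE)
  then have M: "a n \<le> M" for n using abs_le_D1[of "a n" M] by simp
  have "norm (f (Suc n) - f n) \<le> sqrt M * (1 / sqrt 2) ^ n" for n
  proof -
    have "(1/2) ^ n * 2 ^ n = (1 :: real)"
      unfolding power_mult_distrib[symmetric] by simp
    then have "(norm (f (Suc n) - f n))\<^sup>2 = (1/2) ^ n * a n"
      unfolding a_def mult.assoc[symmetric] by (simp only: mult_1)
    also have "\<dots> \<le> (1/2) ^ n * M" by (intro mult_left_mono M) simp
    finally have "sqrt ((norm (f (Suc n) - f n))\<^sup>2) \<le> sqrt ((1/2) ^ n * M)"
      by (rule real_sqrt_le_mono)
    also have "sqrt ((1/2) ^ n * M) = (1 / sqrt 2) ^ n * sqrt M"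
      unfolding real_sqrt_mult real_sqrt_power real_sqrt_divide by (simp only: real_sqrt_one)
    finally show ?thesis by (simp only: real_sqrt_abs abs_norm_cancel mult.commute)
  qed
  moreover have "summable (\<lambda>n. sqrt M * (1 / sqrt 2) ^ n)"
    by (intro summable_mult summable_geometric) simp
  ultimately have "summable (\<lambda>n. f (Suc n) - f n)"
    by (blast intro: summable_comparison_test')
  then have "(\<lambda>n. \<Sum>k<n. f (Suc k) - f k) \<longlonglongrightarrow> (\<Sum>k. f (Suc k) - f k)"
    by (rule summable_LIMSEQ)
  then have "(\<lambda>n. f n - f 0 + f 0) \<longlonglongrightarrow> (\<Sum>k. f (Suc k) - f k) + f 0"
    unfolding sum_lessThan_telescope by (intro tendsto_intros)
  then show ?thesis by (auto simp: convergent_def)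
qed

text \<open>
  The theorem of Riesz and Fischer. Along a sequence of indices \<open>r n\<close> with increments of norm at most
  \<open>(1/2) ^ n\<close>, the integral of the sum of \<open>2 ^ n * |f (n + 1) - f n|^2\<close> is finite, so representatives
  converge almost everywhere; Fatou's lemma identifies the pointwise limit as the limit in norm.
\<close>

instance L2 :: complete_space
proof
  fix X :: "nat \<Rightarrow> L2" assume "Cauchy X"
  then have "\<forall>n. \<exists>N. \<forall>k\<ge>N. \<forall>m\<ge>N. norm (X k - X m) < (1/2) ^ n"
    by (auto simp: Cauchy_iff)
  from choice[OF this] obtain N where N: "\<And>n k m. k \<ge> N n \<Longrightarrow> m \<ge> N n \<Longrightarrow> norm (X k - X m) < (1/2) ^ n"
    by auto
  \<comment> \<open>Summing the thresholds makes \<open>r\<close> monotone and keeps \<open>r m\<close> above \<open>N n\<close> for all \<open>n \<le> m\<close>.\<close>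
  define r where "r n = (\<Sum>k\<le>n. N k)" for n
  have rN: "r m \<ge> N n" if "n \<le> m" for n m
    unfolding r_def using that by (intro member_le_sum) auto
  define f where "f n = rep_L2 (X (r n))" for n
  have [measurable]: "f n \<in> borel_measurable lebesgue" for n by (simp add: f_def)
  have bd: "(\<integral>\<^sup>+x. ennreal ((norm (f m x - f n x))\<^sup>2) \<partial>lebesgue) \<le> ennreal ((1/4) ^ n)" if "n \<le> m" for m n
  proof -
    have "(norm (X (r m) - X (r n)))\<^sup>2 \<le> ((1/2) ^ n)\<^sup>2"
      using less_imp_le[OF N[OF rN[OF that] rN[OF order.refl]]] by (intro power_mono) auto
    also have "\<dots> = (1/4) ^ n" by (rule quarter_power[symmetric])
    finally show ?thesis unfolding f_def L2_nn_integral_diff by (rule ennreal_leI)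
  qed
  have "(\<integral>\<^sup>+x. (\<Sum>n. ennreal (2 ^ n * (norm (f (Suc n) x - f n x))\<^sup>2)) \<partial>lebesgue)
      = (\<Sum>n. ennreal (2 ^ n) * (\<integral>\<^sup>+x. ennreal ((norm (f (Suc n) x - f n x))\<^sup>2) \<partial>lebesgue))"
  proof -
    have "(\<integral>\<^sup>+x. ennreal (2 ^ n * (norm (f (Suc n) x - f n x))\<^sup>2) \<partial>lebesgue)
        = ennreal (2 ^ n) * (\<integral>\<^sup>+x. ennreal ((norm (f (Suc n) x - f n x))\<^sup>2) \<partial>lebesgue)" for n
    proof -
      have "ennreal (2 ^ n * (norm (f (Suc n) x - f n x))\<^sup>2) = ennreal (2 ^ n) * ennreal ((norm (f (Suc n) x - f n x))\<^sup>2)" for x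
        by (rule ennreal_mult) auto
      then show ?thesis by (simp only:) (rule nn_integral_cmult, measurable)
    qed
    moreover have "(\<integral>\<^sup>+x. (\<Sum>n. ennreal (2 ^ n * (norm (f (Suc n) x - f n x))\<^sup>2)) \<partial>lebesgue)
      = (\<Sum>n. \<integral>\<^sup>+x. ennreal (2 ^ n * (norm (f (Suc n) x - f n x))\<^sup>2) \<partial>lebesgue)"
      by (rule nn_integral_suminf) measurable
    ultimately show ?thesis by (simp only:)
  qed
  also have "\<dots> \<le> (\<Sum>n. ennreal ((1/2) ^ n))"
  proof (intro suminf_le)
    fix n
    have "ennreal (2 ^ n) * (\<integral>\<^sup>+x. ennreal ((norm (f (Suc n) x - f n x))\<^sup>2) \<partial>lebesgue) \<le> ennreal (2 ^ n) * ennreal ((1/4) ^ n)"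
      by (intro mult_left_mono bd) auto
    also have "\<dots> = ennreal ((1/2) ^ n)"
    proof -
      have "2 ^ n * (1/4) ^ n = (1/2 :: real) ^ n"
        unfolding power_mult_distrib[symmetric] by simp
      then show ?thesis by (subst ennreal_mult[symmetric]) auto
    qed
    finally show "ennreal (2 ^ n) * (\<integral>\<^sup>+x. ennreal ((norm (f (Suc n) x - f n x))\<^sup>2) \<partial>lebesgue) \<le> ennreal ((1/2) ^ n)" .
  qed auto
  also have "\<dots> < \<infinity>"
  proof -
    have "(\<Sum>n. ennreal ((1/2) ^ n)) = ennreal (\<Sum>n. (1/2) ^ n)"
      by (rule suminf_ennreal2, simp, rule summable_geometric, simp)
    then show ?thesis by (simp only: infinity_ennreal_def ennreal_less_top)
  qed
  finally have "AE x in lebesgue. (\<Sum>n. ennreal (2 ^ n * (norm (f (Suc n) x - f n x))\<^sup>2)) \<noteq> \<infinity>"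
    by (intro nn_integral_noteq_infinite less_imp_neq) measurable
  then have ae: "AE x in lebesgue. (\<lambda>n. f n x) \<longlonglongrightarrow> lim (\<lambda>n. f n x)"
  proof eventually_elim
    case (elim x)
    from weighted_square_summable_imp_convergent[OF elim] show ?case
      by (simp only: convergent_LIMSEQ_iff)
  qed
  define F where "F x = lim (\<lambda>n. f n x)" for x
  have [measurable]: "F \<in> borel_measurable lebesgue"
    unfolding F_def by (intro borel_measurable_lim_metric) measurable
  have FB: "(\<integral>\<^sup>+x. ennreal ((norm (F x - f n x))\<^sup>2) \<partial>lebesgue) \<le> ennreal ((1/4) ^ n)" for n
  proof -
    have "(\<integral>\<^sup>+x. ennreal ((norm (F x - f n x))\<^sup>2) \<partial>lebesgue)
        = (\<integral>\<^sup>+x. liminf (\<lambda>m. ennreal ((norm (f m x - f n x))\<^sup>2)) \<partial>lebesgue)"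
    proof (rule nn_integral_cong_AE)
      show "AE x in lebesgue. ennreal ((norm (F x - f n x))\<^sup>2) = liminf (\<lambda>m. ennreal ((norm (f m x - f n x))\<^sup>2))"
        using ae
      proof eventually_elim
        case (elim x)
        have "(\<lambda>m. ennreal ((norm (f m x - f n x))\<^sup>2)) \<longlonglongrightarrow> ennreal ((norm (F x - f n x))\<^sup>2)"
          unfolding F_def by (intro tendsto_ennrealI tendsto_intros elim)
        then show ?case by (rule lim_imp_Liminf[OF sequentially_bot, symmetric])
      qed
    qed
    also have "\<dots> \<le> liminf (\<lambda>m. \<integral>\<^sup>+x. ennreal ((norm (f m x - f n x))\<^sup>2) \<partial>lebesgue)"
      by (intro nn_integral_liminf) measurable
    also have "\<dots> \<le> liminf (\<lambda>m. ennreal ((1/4) ^ n))"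
      using bd by (intro Liminf_mono) (auto simp: eventually_sequentially)
    also have "\<dots> = ennreal ((1/4) ^ n)" by (simp add: Liminf_const)
    finally show ?thesis .
  qed
  have sqd: "sq_integrable (\<lambda>x. F x - f n x)" for n
    unfolding sq_integrable_def
  proof (intro conjI integrableI_bounded)
    have "(\<integral>\<^sup>+x. ennreal ((norm (F x - f n x))\<^sup>2) \<partial>lebesgue) < \<infinity>"
      using FB[of n] by (rule order_le_less_trans) simp
    then show "(\<integral>\<^sup>+x. ennreal (norm ((norm (F x - f n x))\<^sup>2)) \<partial>lebesgue) < \<infinity>" by simp
  qed measurable
  have sqF: "sq_integrable F"
    using sq_integrable_add[OF sqd[of 0] sq_integrable_rep[of "X (r 0)"]] by (simp add: f_def)
  have close: "norm (X (r n) - abs_L2 F) \<le> (1/2) ^ n" for n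
  proof -
    have "(norm (abs_L2 F - X (r n)))\<^sup>2 = (LINT x|lebesgue. (norm (F x - f n x))\<^sup>2)"
      using abs_L2_diff[OF sqF sq_integrable_rep[of "X (r n)"]] abs_L2_norm[OF sqd[of n]] by (simp add: abs_rep_L2 f_def)
    also have "ennreal \<dots> = (\<integral>\<^sup>+x. ennreal ((norm (F x - f n x))\<^sup>2) \<partial>lebesgue)"
      using sqd[of n] by (intro nn_integral_eq_integral[symmetric]) (auto simp: sq_integrable_def)
    also have "\<dots> \<le> ennreal ((1/4) ^ n)" by (rule FB)
    finally have "(norm (abs_L2 F - X (r n)))\<^sup>2 \<le> (1/4) ^ n" by simp
    also have "\<dots> = ((1/2) ^ n)\<^sup>2" by (rule quarter_power)
    finally show ?thesis by (simp add: norm_minus_commute)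
  qed
  have "X \<longlonglongrightarrow> abs_L2 F"
  proof (rule metric_LIMSEQ_I)
    fix e :: real assume "0 < e"
    then obtain n where n: "(1/2) ^ n < e / 2"
      using real_arch_pow_inv[of "e/2" "1/2"] by auto
    have "norm (X m - abs_L2 F) < e" if "m \<ge> r n" for m
    proof -
      have "norm (X m - abs_L2 F) \<le> norm (X m - X (r n)) + norm (X (r n) - abs_L2 F)"
        using norm_triangle_ineq[of "X m - X (r n)" "X (r n) - abs_L2 F"] by simp
      also have "\<dots> < e"
        using N[of n m "r n"] rN[of n n] that close[of n] n by auto
      finally show ?thesis .
    qed
    then show "\<exists>no. \<forall>m\<ge>no. dist (X m) (abs_L2 F) < e" by (auto simp: dist_norm)
  qed
  then show "convergent X" by (auto simp: convergent_def)
qed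

text \<open>
  As an intersection of kernels of continuous functionals, the space is a closed subspace. The
  converse inclusion tests \<open>u\<close> against its own restriction to the complement.
\<close>

lemma L2_on_eq_orthogonal:
  assumes "open \<Omega>"
  shows "L2_on \<Omega> = {u. \<forall>g. sq_integrable g \<longrightarrow> u \<bullet> abs_L2 (\<lambda>x. indicat_real (- \<Omega>) x *\<^sub>R g x) = 0}"
proof -
  have [measurable]: "- \<Omega> \<in> sets lebesgue" using assms by auto
  have sq: "sq_integrable (\<lambda>x. indicat_real (- \<Omega>) x *\<^sub>R g x)" if "sq_integrable g" for g
  proof -
    have [measurable]: "g \<in> borel_measurable lebesgue" using that by (simp add: sq_integrable_def)
    have "integrable lebesgue (\<lambda>x. (norm (indicat_real (- \<Omega>) x *\<^sub>R g x))\<^sup>2)"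
    proof (rule Bochner_Integration.integrable_bound)
      show "integrable lebesgue (\<lambda>x. (norm (g x))\<^sup>2)" using that by (simp add: sq_integrable_def)
      show "(\<lambda>x. (norm (indicat_real (- \<Omega>) x *\<^sub>R g x))\<^sup>2) \<in> borel_measurable lebesgue" by measurable
    qed (auto simp: indicator_def)
    then show ?thesis by (simp add: sq_integrable_def)
  qed
  show ?thesis
  proof (intro set_eqI iffI)
    fix u assume "u \<in> L2_on \<Omega>"
    then have u: "AE x in lebesgue. x \<notin> \<Omega> \<longrightarrow> rep_L2 u x = 0" by (simp add: L2_on_def)
    show "u \<in> {u. \<forall>g. sq_integrable g \<longrightarrow> u \<bullet> abs_L2 (\<lambda>x. indicat_real (- \<Omega>) x *\<^sub>R g x) = 0}"
    proof (safe)
      fix g assume g: "sq_integrable g"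
      show "u \<bullet> abs_L2 (\<lambda>x. indicat_real (- \<Omega>) x *\<^sub>R g x) = 0"
        unfolding L2_inner_abs[OF sq[OF g]]
        by (rule integral_eq_zero_AE) (use u in \<open>auto elim!: eventually_mono simp: indicator_def\<close>)
    qed
  next
    fix u assume "u \<in> {u. \<forall>g. sq_integrable g \<longrightarrow> u \<bullet> abs_L2 (\<lambda>x. indicat_real (- \<Omega>) x *\<^sub>R g x) = 0}"
    then have "u \<bullet> abs_L2 (\<lambda>x. indicat_real (- \<Omega>) x *\<^sub>R rep_L2 u x) = 0"
      using sq_integrable_rep by blast
    then have int0: "(LINT x|lebesgue. rep_L2 u x \<bullet> (indicat_real (- \<Omega>) x *\<^sub>R rep_L2 u x)) = 0"
      by (simp add: L2_inner_abs sq sq_integrable_rep)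
    have "integrable lebesgue (\<lambda>x. rep_L2 u x \<bullet> (indicat_real (- \<Omega>) x *\<^sub>R rep_L2 u x))"
      by (intro sq_integrable_inner sq sq_integrable_rep)
    then have "AE x in lebesgue. rep_L2 u x \<bullet> (indicat_real (- \<Omega>) x *\<^sub>R rep_L2 u x) = 0"
      using int0 by (subst (asm) integral_nonneg_eq_0_iff_AE) auto
    then show "u \<in> L2_on \<Omega>"
      by (auto simp: L2_on_def indicator_def elim!: eventually_mono)
  qed
qed

lemma closed_L2_on: "open \<Omega> \<Longrightarrow> closed (L2_on \<Omega>)"
  and subspace_L2_on: "open \<Omega> \<Longrightarrow> subspace (L2_on \<Omega>)"
  unfolding L2_on_eq_orthogonal
  by (auto simp: subspace_def inner_add_left intro!: closed_Collect_all closed_Collect_imp closed_Collect_eq continuous_intros)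

section \<open>Integrals of derivatives with compact support\<close>

lemma integral_translate_lborel:
  fixes g :: "'a::euclidean_space \<Rightarrow> real"
  assumes [measurable]: "g \<in> borel_measurable borel"
  shows "(LINT x|lborel. g (x + a)) = (LINT x|lborel. g x)"
proof -
  have "(LINT x|lborel. g x) = (LINT x|distr lborel borel ((+) a). g x)" by (simp add: lborel_distr_plus)
  also have "\<dots> = (LINT x|lborel. g (a + x))" by (rule integral_distr) auto
  finally show ?thesis by (simp add: add.commute)
qed

lemma partial_eq_0_outside_support:
  assumes "x \<notin> closure {x. v x \<noteq> 0}"
  shows "partial i v x = 0"
proof -
  have "(v has_derivative (\<lambda>h. 0)) (at x)"
  proof (rule has_derivative_transform_within_open)
    show "((\<lambda>_. 0) has_derivative (\<lambda>h. 0)) (at x)" by (rule has_derivative_const)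
    show "open (- closure {x. v x \<noteq> 0})" by (rule open_Compl[OF closed_closure])
    show "x \<in> - closure {x. v x \<noteq> 0}" using assms by simp
    show "0 = v y" if "y \<in> - closure {x. v x \<noteq> 0}" for y
      using that subsetD[OF closure_subset[of "{x. v x \<noteq> 0}"], of y] by auto
  qed
  then show ?thesis by (rule partial_eqI)
qed

lemma continuous_compact_support_integrable:
  fixes g :: "real^2 \<Rightarrow> 'b::{banach, second_countable_topology}"
  assumes "continuous_on UNIV g" "compact K" "\<And>x. x \<notin> K \<Longrightarrow> g x = 0"
  shows "integrable lborel g" "integrable lebesgue g"
proof -
  have "integrable lborel (\<lambda>x. indicator K x *\<^sub>R g x)"
    by (rule borel_integrable_compact[OF assms(2) continuous_on_subset[OF assms(1) subset_UNIV]])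
  also have "(\<lambda>x. indicator K x *\<^sub>R g x) = g" using assms(3) by (auto simp: indicator_def)
  finally show "integrable lborel g" .
  then show "integrable lebesgue g"
    using borel_measurable_continuous_onI[OF assms(1)] by (simp add: integrable_completion)
qed

text \<open>
  By translation invariance the difference quotients of \<open>g\<close> have integral zero, and they
  converge boundedly, within a fixed ball, to the partial derivative.
\<close>

lemma integral_partial_eq_0:
  assumes g: "smooth g" and K: "compact (closure {x. g x \<noteq> 0})"
  shows "(LINT x|lebesgue. partial i g x) = 0"
proof -
  define K where "K = closure {x. g x \<noteq> 0}"
  have g0: "g x = 0" if "x \<notin> K" for x
    using that subsetD[OF closure_subset[of "{x. g x \<noteq> 0}"], of x] by (auto simp: K_def)
  have p0: "partial i g x = 0" if "x \<notin> K" for x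
    using that unfolding K_def by (rule partial_eq_0_outside_support)
  have cont: "continuous_on UNIV g" "continuous_on UNIV (partial i g)"
    using g by (auto intro: smooth_continuous smooth_partial)
  have [measurable]: "g \<in> borel_measurable borel"
    by (rule borel_measurable_continuous_onI[OF cont(1)])
  have [measurable]: "partial i g \<in> borel_measurable borel"
    by (rule borel_measurable_continuous_onI[OF cont(2)])
  have int: "integrable lborel g"
    by (rule continuous_compact_support_integrable[OF cont(1) K]) (rule g0[unfolded K_def])
  obtain R where "K \<subseteq> ball 0 R"
    using bounded_subset_ballD[OF compact_imp_bounded[OF K], of 0] unfolding K_def by blast
  then have R: "K \<subseteq> cball 0 R" using ball_subset_cball by (rule order_trans)
  have "compact (partial i g ` K)"
    using K unfolding K_def[symmetric]
    by (rule compact_continuous_image[OF continuous_on_subset[OF cont(2) subset_UNIV]])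
  then have "bounded (partial i g ` K)" by (rule compact_imp_bounded)
  then obtain M where M0: "M > 0" "\<forall>y\<in>partial i g ` K. norm y \<le> M" unfolding bounded_pos by blast
  have M: "\<bar>partial i g x\<bar> \<le> M" for x
  proof (cases "x \<in> K")
    case True
    then have "norm (partial i g x) \<le> M" using M0(2) by blast
    then show ?thesis by simp
  qed (simp add: p0 less_imp_le[OF M0(1)])
  define h where "h n = inverse (real (Suc n))" for n
  have h: "0 < h n" "h n \<le> 1" for n by (auto simp: h_def inverse_le_1_iff)
  have h0: "h \<longlonglongrightarrow> 0" unfolding h_def by (rule LIMSEQ_inverse_real_of_nat)
  define s where "s n x = (g (x + h n *\<^sub>R axis i 1) - g x) / h n" for n x
  have [measurable]: "s n \<in> borel_measurable borel" for n unfolding s_def by measurable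
  have "(\<lambda>n. LINT x|lborel. s n x) \<longlonglongrightarrow> (LINT x|lborel. partial i g x)"
  proof (rule integral_dominated_convergence[where w = "\<lambda>x. M * indicator (cball 0 (R + 1)) x"])
    show "integrable lborel (\<lambda>x. M * indicator (cball 0 (R + 1)) x)"
      by (intro integrable_mult_right integrable_real_indicator emeasure_compact_finite compact_cball)
        simp
    show "AE x in lborel. (\<lambda>n. s n x) \<longlonglongrightarrow> partial i g x"
    proof (rule AE_I2)
      fix x
      have "(\<lambda>k. (g (x + k *\<^sub>R axis i 1) - g (x + 0 *\<^sub>R axis i 1)) / k) \<midarrow>0\<rightarrow> partial i g x"
        using has_derivative_partial[OF smooth_differentiable[OF g]] unfolding DERIV_def by simp
      moreover have "filterlim h (at 0) sequentially"
        using h h0 by (intro filterlim_atI) (auto intro!: always_eventually simp: less_imp_neq[THEN not_sym])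
      ultimately show "(\<lambda>n. s n x) \<longlonglongrightarrow> partial i g x"
        unfolding s_def by (auto dest: filterlim_compose)
    qed
    show "AE x in lborel. norm (s n x) \<le> M * indicator (cball 0 (R + 1)) x" for n
    proof (rule AE_I2)
      fix x
      obtain t where t: "g (x + h n *\<^sub>R axis i 1) - g x = h n * partial i g (x + t *\<^sub>R axis i 1)"
        by (rule partial_mean_value[OF smooth_differentiable[OF g] h(1)])
      show "norm (s n x) \<le> M * indicator (cball 0 (R + 1)) x"
      proof (cases "x \<in> cball 0 (R + 1)")
        case True
        then show ?thesis using h[of n] M by (simp add: s_def t)
      next
        case False
        have "norm x \<le> norm (x + h n *\<^sub>R axis i 1) + norm (h n *\<^sub>R (axis i 1 :: real^2))"
          using norm_triangle_ineq4[of "x + h n *\<^sub>R axis i 1" "h n *\<^sub>R axis i 1"] by (simp only: add_diff_cancel_right')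
        then have "norm x \<le> norm (x + h n *\<^sub>R axis i 1) + 1" using h[of n] by simp
        then have "x \<notin> K" "x + h n *\<^sub>R axis i 1 \<notin> K" using False R by auto
        then show ?thesis using False by (simp add: s_def g0)
      qed
    qed
  qed auto
  moreover have "(LINT x|lborel. s n x) = 0" for n
  proof -
    have "integrable (distr lborel borel ((+) (h n *\<^sub>R axis i 1))) g"
      using int by (simp only: lborel_distr_plus)
    then have "integrable lborel (\<lambda>x. g (x + h n *\<^sub>R axis i 1))"
      by (subst (asm) integrable_distr_eq) (auto simp: add.commute)
    then show ?thesis
      unfolding s_def using int by (simp add: integral_translate_lborel)
  qed
  ultimately have "(LINT x|lborel. partial i g x) = 0"
    by (simp add: LIMSEQ_const_iff)
  then show ?thesis by (simp add: integral_completion)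
qed

section \<open>A smooth truncation\<close>

text \<open>
  The truncation of \<open>s\<close> to \<open>[-1, 1]\<close> is \<open>(|s + 1| - |s - 1|) / 2\<close>; here the absolute values are smoothed.
\<close>

definition soft_clamp :: "real \<Rightarrow> real \<Rightarrow> real" where
  "soft_clamp h s = (sqrt ((s + 1)\<^sup>2 + h\<^sup>2) - sqrt ((s - 1)\<^sup>2 + h\<^sup>2)) / 2"

lemma soft_clamp_0: "soft_clamp h 0 = 0"
  by (simp add: soft_clamp_def)

text \<open>
  The two roots are the distances of \<open>s + i h\<close> from \<open>-1\<close> and \<open>1\<close> in the complex plane.
\<close>

lemma abs_soft_clamp_le_1: "\<bar>soft_clamp h s\<bar> \<le> 1"
proof -
  have "\<bar>cmod (Complex (s + 1) h) - cmod (Complex (s - 1) h)\<bar> \<le> cmod (Complex (s + 1) h - Complex (s - 1) h)"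
    by (rule norm_triangle_ineq3)
  also have "Complex (s + 1) h - Complex (s - 1) h = 2" by (simp add: complex_eq_iff)
  finally show ?thesis by (simp add: soft_clamp_def complex_norm)
qed

lemma soft_clamp_has_derivative:
  assumes "h > 0"
  obtains D where "(soft_clamp h has_real_derivative D) (at s)" "\<bar>D\<bar> \<le> 1"
proof -
  have pos: "x\<^sup>2 + h\<^sup>2 > 0" for x using assms by (intro add_nonneg_pos zero_le_power2 zero_less_power)
  have le: "\<bar>x / sqrt (x\<^sup>2 + h\<^sup>2)\<bar> \<le> 1" for x
  proof -
    have "\<bar>x\<bar> \<le> sqrt (x\<^sup>2 + h\<^sup>2)" by (rule real_sqrt_ge_abs1)
    then show ?thesis using pos[of x] by (simp add: divide_le_eq_1)
  qed
  have root: "((\<lambda>s. sqrt ((s + c)\<^sup>2 + h\<^sup>2)) has_real_derivative (s + c) / sqrt ((s + c)\<^sup>2 + h\<^sup>2)) (at s)" for c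
  proof -
    have inner: "((\<lambda>s. (s + c)\<^sup>2 + h\<^sup>2) has_real_derivative 2 * (s + c)) (at s)"
      by (auto intro!: derivative_eq_intros)
    have "inverse r / 2 * (2 * b) = b / r" for r b :: real
      by (cases "r = 0") (simp_all add: field_simps)
    then show ?thesis
      using DERIV_chain2[OF DERIV_real_sqrt[OF pos[of "s + c"]] inner] by (simp only:)
  qed
  have half: "\<bar>(x - y) / 2\<bar> \<le> 1" if "\<bar>x\<bar> \<le> 1" "\<bar>y\<bar> \<le> 1" for x y :: real
    using that unfolding diff_divide_distrib by linarith
  show thesis
  proof
    show "(soft_clamp h has_real_derivative
        ((s + 1) / sqrt ((s + 1)\<^sup>2 + h\<^sup>2) - (s - 1) / sqrt ((s - 1)\<^sup>2 + h\<^sup>2)) / 2) (at s)"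
      using DERIV_cdivide[OF DERIV_diff[OF root[of 1] root[of "-1"]], of 2]
      unfolding soft_clamp_def[abs_def] by simp
    show "\<bar>((s + 1) / sqrt ((s + 1)\<^sup>2 + h\<^sup>2) - (s - 1) / sqrt ((s - 1)\<^sup>2 + h\<^sup>2)) / 2\<bar> \<le> 1"
      by (rule half[OF le le])
  qed
qed

lemma soft_clamp_near_clamp:
  assumes "h > 0"
  shows "\<bar>soft_clamp h s - (\<bar>s + 1\<bar> - \<bar>s - 1\<bar>) / 2\<bar> \<le> h"
proof -
  have "\<bar>x\<bar> \<le> sqrt (x\<^sup>2 + h\<^sup>2)" for x by (rule real_sqrt_ge_abs1)
  moreover have "sqrt (x\<^sup>2 + h\<^sup>2) \<le> \<bar>x\<bar> + h" for x
    using sqrt_sum_squares_le_sum_abs[of x h] assms by simp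
  moreover have "\<bar>r - a\<bar> \<le> h" if "a \<le> r" "r \<le> a + h" for a r :: real
    using that assms by linarith
  ultimately have "\<bar>sqrt (x\<^sup>2 + h\<^sup>2) - \<bar>x\<bar>\<bar> \<le> h" for x by blast
  moreover have "\<bar>(r - r') / 2 - (a - a') / 2\<bar> \<le> h" if "\<bar>r - a\<bar> \<le> h" "\<bar>r' - a'\<bar> \<le> h" for r r' a a' :: real
    using that unfolding diff_divide_distrib by linarith
  ultimately show ?thesis unfolding soft_clamp_def by blast
qed

text \<open>
  The argument of the truncation is \<open>v + z\<close> with \<open>z = e (v - w)\<close>, and \<open>|w| \<le> 1\<close> gives
  \<open>v - 1 \<le> z \<le> v + 1\<close>. So the reflected value \<open>v - z\<close> lies in \<open>[-1, 1]\<close>, and truncating \<open>v + z\<close> only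
  moves the reflected value towards \<open>v\<close>.
\<close>

lemma reflected_clamp_le:
  fixes v w e h :: real
  assumes "\<bar>v\<bar> \<le> 1" "\<bar>w\<bar> \<le> 1" "0 < e" "e < 1" "h > 0"
  shows "\<bar>2 * v - soft_clamp h ((1 + e) * v - e * w)\<bar> \<le> 1 + h"
proof -
  define z where "z = e * (v - w)"
  have "e * (1 - v) \<le> 1 - v" "e * (1 + v) \<le> 1 + v"
    using assms by (auto intro!: mult_left_le_one_le)
  moreover have "e * (v - w) \<le> e * (1 + v)" "- (e * (1 - v)) \<le> e * (v - w)"
    using assms mult_left_mono[of "v - w" "1 + v" e] mult_left_mono[of "- (1 - v)" "v - w" e] by linarith+
  ultimately have z: "z \<le> 1 + v" "- (1 - v) \<le> z" by (auto simp: z_def)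
  have eq: "(1 + e) * v - e * w = v + z" by (simp add: z_def algebra_simps)
  define c where "c = (\<bar>v + z + 1\<bar> - \<bar>v + z - 1\<bar>) / 2"
  have "\<bar>2 * v - c\<bar> \<le> 1"
  proof -
    consider "v + z \<le> -1" | "v + z \<ge> -1" "v + z \<le> 1" | "v + z \<ge> 1" by linarith
    then show ?thesis
    proof cases
      case 1
      then have "c = -1" by (simp add: c_def abs_if field_simps)
      then show ?thesis using z assms(1) 1 by linarith
    next
      case 2
      then have "c = v + z" by (simp add: c_def abs_if field_simps)
      then show ?thesis using z assms(1) 2 by linarith
    next
      case 3
      then have "c = 1" by (simp add: c_def abs_if field_simps)
      then show ?thesis using z assms(1) 3 by linarith
    qed
  qed
  then show ?thesis using soft_clamp_near_clamp[OF assms(5), of "v + z"] unfolding eq c_def[symmetric] by linarith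
qed

lemma smooth_soft_clamp:
  assumes "smooth v" "h > 0"
  shows "smooth (\<lambda>x. soft_clamp h (v x))"
proof -
  have pos: "(v x + c)\<^sup>2 + h\<^sup>2 > 0" for x c using assms by (intro add_nonneg_pos zero_le_power2 zero_less_power)
  have sm: "smooth (\<lambda>x. sqrt ((v x + c)\<^sup>2 + h\<^sup>2))" for c
  proof -
    have "smooth (\<lambda>x. ((v x + c) * (v x + c) + h\<^sup>2) powr (1/2))"
      using assms pos[of _ c] by (intro smooth_powr smooth_add smooth_mult smooth_const) (auto simp: power2_eq_square)
    then show ?thesis using pos by (simp add: powr_half_sqrt less_imp_le power2_eq_square)
  qed
  have "smooth (\<lambda>x. 1/2 * sqrt ((v x + 1)\<^sup>2 + h\<^sup>2) + (- 1/2) * sqrt ((v x + -1)\<^sup>2 + h\<^sup>2))"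
    by (intro smooth_add smooth_cmult sm)
  then show ?thesis by (simp add: soft_clamp_def diff_divide_distrib)
qed

section \<open>Gradient fields of bounded potentials\<close>

text \<open>
  The rotation by a right angle that takes gradients to perpendicular gradients.
\<close>

definition rot :: "real^2 \<Rightarrow> real^2" where
  "rot y = vector [y $ 2, - (y $ 1)]"

lemma perp_grad_eq_rot: "perp_grad v x = rot (grad v x)"
  by (simp add: perp_grad_def rot_def grad_def)

lemma linear_rot: "linear rot"
  by (rule linearI) (simp_all add: rot_def vec_eq_iff forall_2)

lemma norm_rot: "norm (rot y) = norm y"
  by (simp add: rot_def norm_eq inner_vec_def sum_2 add.commute)

lemma grad_eq_axis: "grad v x = partial 1 v x *\<^sub>R axis 1 1 + partial 2 v x *\<^sub>R axis 2 1"
  by (simp add: grad_def vec_eq_iff forall_2 axis_def)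

lemma continuous_on_grad: "smooth v \<Longrightarrow> continuous_on UNIV (grad v)"
  unfolding grad_eq_axis[abs_def] by (intro continuous_intros smooth_continuous smooth_partial)

lemma grad_eq_0_outside_support: "x \<notin> closure {x. v x \<noteq> 0} \<Longrightarrow> grad v x = 0"
  by (simp add: grad_eq_axis partial_eq_0_outside_support)

lemma grad_linear_combination:
  assumes "smooth v" "smooth w"
  shows "grad (\<lambda>x. a * v x + b * w x) x = a *\<^sub>R grad v x + b *\<^sub>R grad w x"
proof -
  have "partial i (\<lambda>x. a * v x + b * w x) x = a * partial i v x + b * partial i w x" for i
    using partial_add[OF smooth_differentiable[OF smooth_cmult[OF assms(1)]] smooth_differentiable[OF smooth_cmult[OF assms(2)]]]
    by (simp add: partial_cmult assms)
  then show ?thesis by (simp add: grad_eq_axis algebra_simps)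
qed

lemma grad_compose:
  assumes "smooth v" "(F has_real_derivative F') (at (v x))"
  shows "grad (\<lambda>x. F (v x)) x = F' *\<^sub>R grad v x"
  using partial_compose[OF smooth_differentiable[OF assms(1)] assms(2)]
  by (simp add: grad_eq_axis algebra_simps)

lemma continuous_compact_support_sq_integrable:
  fixes \<phi> :: "real^2 \<Rightarrow> real^2"
  assumes "continuous_on UNIV \<phi>" "compact K" "\<And>x. x \<notin> K \<Longrightarrow> \<phi> x = 0"
  shows "sq_integrable \<phi>"
proof -
  have "integrable lebesgue (\<lambda>x. (norm (\<phi> x))\<^sup>2)"
    by (rule continuous_compact_support_integrable(2)[OF _ assms(2)])
      (use assms in \<open>auto intro!: continuous_intros\<close>)
  then show ?thesis
    using borel_measurable_continuous_onI[OF assms(1)] by (simp add: sq_integrable_def measurable_completion)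
qed

lemma compactly_supportedI:
  fixes v :: "real^2 \<Rightarrow> 'b::zero"
  assumes "compact K" "K \<subseteq> \<Omega>" "\<And>x. x \<notin> K \<Longrightarrow> v x = 0"
  shows "compactly_supported \<Omega> v"
proof -
  have "closure {x. v x \<noteq> 0} \<subseteq> K"
    by (rule closure_minimal[OF _ compact_imp_closed[OF assms(1)]]) (use assms(3) in blast)
  then show ?thesis
    using assms(1,2) compact_Int_closed[OF assms(1) closed_closure, of "{x. v x \<noteq> 0}"]
    unfolding compactly_supported_def by (auto simp: Int_absorb1)
qed

lemma Cc_smooth_unitD:
  assumes "v \<in> Cc_smooth_unit \<Omega>"
  shows "smooth v" "compact (closure {x. v x \<noteq> 0})" "closure {x. v x \<noteq> 0} \<subseteq> \<Omega>" "\<bar>v x\<bar> \<le> 1"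
  using assms by (auto simp: Cc_smooth_unit_def compactly_supported_def abs_le_iff)

lemma eq_0_outside_support: "x \<notin> closure {x. v x \<noteq> 0} \<Longrightarrow> v x = 0"
  using subsetD[OF closure_subset[of "{x. v x \<noteq> 0}"], of x] by auto

lemma Cc_smooth_unitI:
  assumes "v \<in> Cc_smooth_unit \<Omega>" "w \<in> Cc_smooth_unit \<Omega>" "smooth z" "\<And>x. v x = 0 \<Longrightarrow> w x = 0 \<Longrightarrow> z x = 0"
    "\<And>x. \<bar>z x\<bar> \<le> 1"
  shows "z \<in> Cc_smooth_unit \<Omega>"
proof -
  let ?K = "closure {x. v x \<noteq> 0} \<union> closure {x. w x \<noteq> 0}"
  have "compactly_supported \<Omega> z"
  proof (rule compactly_supportedI)
    show "compact ?K" by (rule compact_Un[OF Cc_smooth_unitD(2)[OF assms(1)] Cc_smooth_unitD(2)[OF assms(2)]])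
    show "?K \<subseteq> \<Omega>" by (rule Un_least[OF Cc_smooth_unitD(3)[OF assms(1)] Cc_smooth_unitD(3)[OF assms(2)]])
    show "z x = 0" if "x \<notin> ?K" for x
      by (rule assms(4)) (use that eq_0_outside_support[of x v] eq_0_outside_support[of x w] in simp_all)
  qed
  moreover have "z x \<in> {-1..1}" for x using assms(5)[of x] by (simp add: abs_le_iff)
  ultimately show ?thesis using assms(3) by (simp add: Cc_smooth_unit_def)
qed

text \<open>
  The map \<open>M\<close> is the negation for \<open>J_div\<close> and the rotation for \<open>J_rot\<close>. Truncating potentials works for
  every linear isometry \<open>M\<close>, so one argument serves both functionals.
\<close>

definition gradient_fields :: "(real^2 \<Rightarrow> real^2) \<Rightarrow> (real^2) set \<Rightarrow> L2 set" where
  "gradient_fields M \<Omega> = (\<lambda>v. abs_L2 (\<lambda>x. M (grad v x))) ` Cc_smooth_unit \<Omega>"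

lemma zero_in_Cc_smooth_unit: "(\<lambda>x. 0) \<in> Cc_smooth_unit \<Omega>"
  by (simp add: Cc_smooth_unit_def smooth_const compactly_supported_def)

lemma sq_integrable_gradient_field:
  assumes "linear M" "v \<in> Cc_smooth_unit \<Omega>"
  shows "sq_integrable (\<lambda>x. M (grad v x))"
  by (rule continuous_compact_support_sq_integrable[OF linear_continuous_on_compose[OF continuous_on_grad[OF Cc_smooth_unitD(1)[OF assms(2)]] assms(1)] Cc_smooth_unitD(2)[OF assms(2)]])
    (simp add: grad_eq_0_outside_support linear_0[OF assms(1)])

lemma gradient_field_linear_combination:
  assumes M: "linear M" and v: "v \<in> Cc_smooth_unit \<Omega>" and w: "w \<in> Cc_smooth_unit \<Omega>"
  shows "a *\<^sub>R abs_L2 (\<lambda>x. M (grad v x)) + b *\<^sub>R abs_L2 (\<lambda>x. M (grad w x))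
    = abs_L2 (\<lambda>x. M (grad (\<lambda>x. a * v x + b * w x) x))"
  using Cc_smooth_unitD(1)[OF v] Cc_smooth_unitD(1)[OF w]
  by (simp add: abs_L2_scaleR abs_L2_add sq_integrable_scaleR sq_integrable_gradient_field[OF M v] sq_integrable_gradient_field[OF M w]
      grad_linear_combination linear_add[OF M] linear_scale[OF M])

lemma gradient_fieldsI:
  assumes "linear M" "v \<in> Cc_smooth_unit \<Omega>" "w \<in> Cc_smooth_unit \<Omega>" "\<And>x. \<bar>a * v x + b * w x\<bar> \<le> 1"
  shows "a *\<^sub>R abs_L2 (\<lambda>x. M (grad v x)) + b *\<^sub>R abs_L2 (\<lambda>x. M (grad w x)) \<in> gradient_fields M \<Omega>"
proof -
  have "(\<lambda>x. a * v x + b * w x) \<in> Cc_smooth_unit \<Omega>"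
    by (rule Cc_smooth_unitI[OF assms(2,3)])
      (use assms Cc_smooth_unitD(1) in \<open>auto intro!: smooth_add smooth_cmult\<close>)
  then show ?thesis
    unfolding gradient_field_linear_combination[OF assms(1-3)] gradient_fields_def by (rule imageI)
qed

lemma convex_gradient_fields:
  assumes "linear M"
  shows "convex (gradient_fields M \<Omega>)"
proof (rule convexI)
  fix x y and s t :: real
  assume xy: "x \<in> gradient_fields M \<Omega>" "y \<in> gradient_fields M \<Omega>" and st: "0 \<le> s" "0 \<le> t" "s + t = 1"
  obtain v w where v: "v \<in> Cc_smooth_unit \<Omega>" "x = abs_L2 (\<lambda>x. M (grad v x))"
    and w: "w \<in> Cc_smooth_unit \<Omega>" "y = abs_L2 (\<lambda>x. M (grad w x))"
    using xy unfolding gradient_fields_def by blast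
  have "\<bar>s * v z + t * w z\<bar> \<le> 1" for z
  proof -
    have "\<bar>s * v z + t * w z\<bar> \<le> s * \<bar>v z\<bar> + t * \<bar>w z\<bar>"
      using abs_triangle_ineq[of "s * v z" "t * w z"] st by (simp add: abs_mult)
    also have "\<dots> \<le> s * 1 + t * 1"
      by (intro add_mono mult_left_mono Cc_smooth_unitD(4)[OF v(1)] Cc_smooth_unitD(4)[OF w(1)] st)
    finally show ?thesis using st by simp
  qed
  then show "s *\<^sub>R x + t *\<^sub>R y \<in> gradient_fields M \<Omega>"
    unfolding v(2) w(2) by (intro gradient_fieldsI assms v(1) w(1))
qed

lemma zero_in_gradient_fields:
  assumes "linear M"
  shows "0 \<in> gradient_fields M \<Omega>"
  using gradient_fieldsI[OF assms zero_in_Cc_smooth_unit zero_in_Cc_smooth_unit, of 0 0 \<Omega>] by simp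

lemma gradient_fields_subset_L2_on:
  assumes "linear M"
  shows "gradient_fields M \<Omega> \<subseteq> L2_on \<Omega>"
proof
  fix q assume "q \<in> gradient_fields M \<Omega>"
  then obtain v where v: "v \<in> Cc_smooth_unit \<Omega>" "q = abs_L2 (\<lambda>x. M (grad v x))"
    unfolding gradient_fields_def by blast
  have "AE x in lebesgue. rep_L2 q x = M (grad v x)"
    unfolding v(2) by (rule rep_abs_L2_AE[OF sq_integrable_gradient_field[OF assms v(1)]])
  then show "q \<in> L2_on \<Omega>"
    unfolding L2_on_def mem_Collect_eq
  proof eventually_elim
    case (elim x)
    show ?case
    proof
      assume "x \<notin> \<Omega>"
      then have "grad v x = 0" using Cc_smooth_unitD(3)[OF v(1)] by (intro grad_eq_0_outside_support) blast
      then show "rep_L2 q x = 0" using elim by (simp add: linear_0[OF assms])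
    qed
  qed
qed

lemma inner_gradient_field:
  assumes "linear M" "v \<in> Cc_smooth_unit \<Omega>"
  shows "abs_L2 (\<lambda>x. M (grad v x)) \<bullet> u = (LINT x:\<Omega>|lebesgue. rep_L2 u x \<bullet> M (grad v x))"
proof -
  have "abs_L2 (\<lambda>x. M (grad v x)) \<bullet> u = (LINT x|lebesgue. rep_L2 u x \<bullet> M (grad v x))"
    by (subst inner_commute) (rule L2_inner_abs[OF sq_integrable_gradient_field[OF assms]])
  also have "\<dots> = (LINT x:\<Omega>|lebesgue. rep_L2 u x \<bullet> M (grad v x))"
    unfolding set_lebesgue_integral_def
  proof (rule Bochner_Integration.integral_cong[OF refl])
    fix x
    show "rep_L2 u x \<bullet> M (grad v x) = indicat_real \<Omega> x *\<^sub>R (rep_L2 u x \<bullet> M (grad v x))"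
    proof (cases "x \<in> \<Omega>")
      case False
      then have "grad v x = 0" using Cc_smooth_unitD(3)[OF assms(2)] by (intro grad_eq_0_outside_support) blast
      then show ?thesis by (simp add: linear_0[OF assms(1)])
    qed simp
  qed
  finally show ?thesis .
qed

lemma linear_neg: "linear (\<lambda>y::real^2. - y)"
  by (rule linearI) simp_all

lemma J_div_eq_support_fun: "J_div \<Omega> = support_fun (gradient_fields (\<lambda>y. - y) \<Omega>)"
proof
  fix u
  have "- (LINT x:\<Omega>|lebesgue. rep_L2 u x \<bullet> grad v x) = abs_L2 (\<lambda>x. - grad v x) \<bullet> u" if "v \<in> Cc_smooth_unit \<Omega>" for v
    using inner_gradient_field[OF linear_neg that, of u] by (simp add: set_lebesgue_integral_def)
  then show "J_div \<Omega> u = support_fun (gradient_fields (\<lambda>y. - y) \<Omega>) u"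
    unfolding J_div_def support_fun_def gradient_fields_def image_image by (intro SUP_cong) auto
qed

lemma J_rot_eq_support_fun: "J_rot \<Omega> = support_fun (gradient_fields rot \<Omega>)"
proof
  fix u
  show "J_rot \<Omega> u = support_fun (gradient_fields rot \<Omega>) u"
    unfolding J_rot_def support_fun_def gradient_fields_def image_image perp_grad_eq_rot
    by (intro SUP_cong) (simp_all add: inner_gradient_field[OF linear_rot])
qed

text \<open>
  The chain rule bounds the gradient of the truncated potential pointwise, since the derivative of the
  soft truncation is at most one; the values of the reflected potential are bounded by \<open>1 + h\<close>.
\<close>

lemma truncatable_gradient_fields:
  assumes M: "linear M" and norm_M: "\<And>y. norm (M y) = norm y"
  shows "truncatable (gradient_fields M \<Omega>)"
  unfolding truncatable_def
proof (intro ballI allI impI)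
  fix q p and e h :: real
  assume q: "q \<in> gradient_fields M \<Omega>" and p: "p \<in> gradient_fields M \<Omega>" and e: "0 < e" "e < 1" and h: "0 < h"
  obtain v w where v: "v \<in> Cc_smooth_unit \<Omega>" "p = abs_L2 (\<lambda>x. M (grad v x))"
    and w: "w \<in> Cc_smooth_unit \<Omega>" "q = abs_L2 (\<lambda>x. M (grad w x))"
    using p q unfolding gradient_fields_def by blast
  note sv = Cc_smooth_unitD(1)[OF v(1)] and sw = Cc_smooth_unitD(1)[OF w(1)]
  define s where "s x = (1 + e) * v x + (- e) * w x" for x
  have ss: "smooth s" unfolding s_def[abs_def] by (intro smooth_add smooth_cmult sv sw)
  define z where "z x = soft_clamp h (s x)" for x
  have z: "z \<in> Cc_smooth_unit \<Omega>"
  proof (rule Cc_smooth_unitI[OF v(1) w(1)])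
    show "smooth z" unfolding z_def[abs_def] by (rule smooth_soft_clamp[OF ss h])
  qed (simp_all add: z_def s_def soft_clamp_0 abs_soft_clamp_le_1)
  define x where "x = abs_L2 (\<lambda>y. M (grad z y))"
  have comb: "(1 + e) *\<^sub>R p - e *\<^sub>R q = abs_L2 (\<lambda>y. M (grad s y))"
    using gradient_field_linear_combination[OF M v(1) w(1), of "1 + e" "- e"]
    unfolding v(2) w(2) s_def[abs_def] by simp
  have sq_s: "sq_integrable (\<lambda>y. M (grad s y))"
    using sq_integrable_add[OF sq_integrable_scaleR[OF sq_integrable_gradient_field[OF M v(1)], of "1 + e"]
        sq_integrable_scaleR[OF sq_integrable_gradient_field[OF M w(1)], of "- e"]]
    unfolding s_def[abs_def] grad_linear_combination[OF sv sw] linear_add[OF M] linear_scale[OF M] .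
  note sq_z = sq_integrable_gradient_field[OF M z]
  have "norm x \<le> norm ((1 + e) *\<^sub>R p - e *\<^sub>R q)"
  proof (rule power2_le_imp_le)
    have le: "(norm (M (grad z y)))\<^sup>2 \<le> (norm (M (grad s y)))\<^sup>2" for y
    proof -
      obtain D where D: "(soft_clamp h has_real_derivative D) (at (s y))" "\<bar>D\<bar> \<le> 1"
        by (rule soft_clamp_has_derivative[OF h])
      have "grad z y = D *\<^sub>R grad s y"
        unfolding z_def[abs_def] by (rule grad_compose[OF ss D(1)])
      then have "norm (grad z y) \<le> norm (grad s y)"
        using D(2) mult_right_mono[OF D(2) norm_ge_zero[of "grad s y"]] by simp
      then show ?thesis unfolding norm_M by (intro power_mono) simp_all
    qed
    show "(norm x)\<^sup>2 \<le> (norm ((1 + e) *\<^sub>R p - e *\<^sub>R q))\<^sup>2"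
      unfolding comb x_def abs_L2_norm[OF sq_z] abs_L2_norm[OF sq_s]
      by (rule integral_mono[OF _ _ le]) (use sq_z sq_s in \<open>simp_all add: sq_integrable_def\<close>)
  qed simp
  moreover have "(1 / (1 + h)) *\<^sub>R (2 *\<^sub>R p - x) \<in> gradient_fields M \<Omega>"
  proof -
    have "\<bar>2 / (1 + h) * v y + (- 1 / (1 + h)) * z y\<bar> \<le> 1" for y
    proof -
      have "\<bar>2 * v y - z y\<bar> \<le> 1 + h"
        using reflected_clamp_le[OF Cc_smooth_unitD(4)[OF v(1)] Cc_smooth_unitD(4)[OF w(1)] e h, of y y]
        by (simp add: z_def s_def)
      moreover have "2 / (1 + h) * v y + (- 1 / (1 + h)) * z y = (2 * v y - z y) / (1 + h)"
        by (simp add: diff_divide_distrib)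
      ultimately show ?thesis using h by (simp add: abs_divide)
    qed
    from gradient_fieldsI[OF M v(1) z this] show ?thesis
      by (simp add: v(2) x_def scaleR_diff_right)
  qed
  moreover have "x \<in> gradient_fields M \<Omega>" unfolding x_def gradient_fields_def by (rule imageI[OF z])
  ultimately show "\<exists>x\<in>gradient_fields M \<Omega>. norm x \<le> norm ((1 + e) *\<^sub>R p - e *\<^sub>R q)
      \<and> (1 / (1 + h)) *\<^sub>R (2 *\<^sub>R p - x) \<in> gradient_fields M \<Omega>"
    by blast
qed

section \<open>Helmholtz decomposition\<close>

lemma sq_integrable_Cc_smooth_field:
  assumes "\<phi> \<in> Cc_smooth_field \<Omega>"
  shows "sq_integrable \<phi>"
proof (rule continuous_compact_support_sq_integrable)
  show "compact (closure {x. \<phi> x \<noteq> 0})"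
    using assms by (simp add: Cc_smooth_field_def compactly_supported_def)
  have "continuous_on UNIV (\<lambda>x. \<phi> x $ 1 *\<^sub>R axis 1 1 + \<phi> x $ 2 *\<^sub>R (axis 2 1 :: real^2))"
    using assms by (intro continuous_intros smooth_continuous) (simp_all add: Cc_smooth_field_def)
  moreover have "(\<lambda>x. \<phi> x $ 1 *\<^sub>R axis 1 1 + \<phi> x $ 2 *\<^sub>R (axis 2 1 :: real^2)) = \<phi>"
    by (simp add: fun_eq_iff vec_eq_iff forall_2 axis_def)
  ultimately show "continuous_on UNIV \<phi>" by (simp only:)
qed (rule eq_0_outside_support)

text \<open>
  For divergence-free \<open>\<phi>\<close> the integrand is the divergence of \<open>v \<phi>\<close>.
\<close>

lemma grad_orthogonal_divergence_free:
  assumes v: "v \<in> Cc_smooth_unit \<Omega>" and \<phi>: "\<phi> \<in> Cc_smooth_field \<Omega>" and div: "\<And>x. divergence \<phi> x = 0"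
  shows "(LINT x|lebesgue. grad v x \<bullet> \<phi> x) = 0"
proof -
  note sv = Cc_smooth_unitD(1)[OF v]
  have s\<phi>: "smooth (\<lambda>x. \<phi> x $ i)" for i using \<phi> by (simp add: Cc_smooth_field_def)
  define g where "g i x = v x * \<phi> x $ i" for i x
  have sg: "smooth (g i)" for i unfolding g_def[abs_def] by (rule smooth_mult[OF sv s\<phi>])
  have sub: "closure {x. g i x \<noteq> 0} \<subseteq> closure {x. v x \<noteq> 0}" for i
    by (rule closure_mono) (auto simp: g_def)
  have K: "compact (closure {x. g i x \<noteq> 0})" for i
    using compact_Int_closed[OF Cc_smooth_unitD(2)[OF v] closed_closure] Int_absorb1[OF sub] by metis
  have "grad v x \<bullet> \<phi> x = partial 1 (g 1) x + partial 2 (g 2) x" for x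
  proof -
    have "partial i (g i) x = v x * partial i (\<lambda>x. \<phi> x $ i) x + partial i v x * \<phi> x $ i" for i
      unfolding g_def[abs_def] by (rule partial_mult[OF smooth_differentiable[OF sv] smooth_differentiable[OF s\<phi>]])
    moreover have "v x * partial 1 (\<lambda>x. \<phi> x $ 1) x + v x * partial 2 (\<lambda>x. \<phi> x $ 2) x = 0"
      using div[of x] by (simp add: divergence_def sum_2 flip: distrib_left)
    ultimately show ?thesis by (simp add: grad_def inner_vec_def sum_2)
  qed
  moreover have "integrable lebesgue (partial i (g i))" for i
    by (rule continuous_compact_support_integrable(2)[OF smooth_continuous[OF smooth_partial[OF sg]] K])
      (rule partial_eq_0_outside_support)
  ultimately show ?thesis
    using integral_partial_eq_0[OF sg K] by simp
qed

text \<open>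
  The divergence is the difference of the two mixed second partial derivatives.
\<close>

lemma perp_grad_divergence_free:
  assumes v: "v \<in> Cc_smooth_unit \<Omega>"
  shows "(\<lambda>x. rot (grad v x)) \<in> Cc_smooth_field \<Omega>" "divergence (\<lambda>x. rot (grad v x)) x = 0"
proof -
  note sv = Cc_smooth_unitD(1)[OF v]
  have 1: "(\<lambda>x. rot (grad v x) $ 1) = partial 2 v" "(\<lambda>x. rot (grad v x) $ 2) = (\<lambda>x. (-1) * partial 1 v x)"
    by (simp_all add: rot_def grad_def)
  have "smooth (\<lambda>x. rot (grad v x) $ 1)" "smooth (\<lambda>x. rot (grad v x) $ 2)"
    unfolding 1 by (intro smooth_cmult smooth_partial sv)+
  then have "smooth (\<lambda>x. rot (grad v x) $ i)" for i
    using exhaust_2[of i] by auto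
  moreover have "compactly_supported \<Omega> (\<lambda>x. rot (grad v x))"
    by (rule compactly_supportedI[OF Cc_smooth_unitD(2,3)[OF v]])
      (simp add: grad_eq_0_outside_support linear_0[OF linear_rot])
  ultimately show "(\<lambda>x. rot (grad v x)) \<in> Cc_smooth_field \<Omega>"
    by (simp add: Cc_smooth_field_def)
  show "divergence (\<lambda>x. rot (grad v x)) x = 0"
    unfolding divergence_def sum_2 1 partial_cmult[OF smooth_partial[OF sv]]
    using partial_commute[OF sv, of 1 2 x] by simp
qed

lemma rot_gradient_fields_subset_L2_sigma: "gradient_fields rot \<Omega> \<subseteq> L2_sigma \<Omega>"
  unfolding gradient_fields_def L2_sigma_def
  using perp_grad_divergence_free closure_subset by (blast intro: subsetD[OF closure_subset])

lemma gradient_fields_orthogonal_L2_sigma: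
  assumes "a \<in> gradient_fields (\<lambda>y. - y) \<Omega>" "w \<in> L2_sigma \<Omega>"
  shows "a \<bullet> w = 0"
proof -
  obtain v where v: "v \<in> Cc_smooth_unit \<Omega>" "a = abs_L2 (\<lambda>x. - grad v x)"
    using assms(1) unfolding gradient_fields_def by blast
  have "L2_sigma \<Omega> \<subseteq> {w. a \<bullet> w = 0}"
    unfolding L2_sigma_def
  proof (rule closure_minimal[OF _ closed_hyperplane], safe)
    fix \<phi> assume \<phi>: "\<phi> \<in> Cc_smooth_field \<Omega>" "\<forall>x. divergence \<phi> x = 0"
    have "a \<bullet> abs_L2 \<phi> = (LINT x|lebesgue. - grad v x \<bullet> \<phi> x)"
      unfolding v(2) by (rule abs_L2_inner[OF sq_integrable_gradient_field[OF linear_neg v(1)] sq_integrable_Cc_smooth_field[OF \<phi>(1)]])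
    also have "\<dots> = 0"
      using grad_orthogonal_divergence_free[OF v(1) \<phi>(1)] \<phi>(2) by simp
    finally show "a \<bullet> abs_L2 \<phi> = 0" .
  qed
  then show ?thesis using assms(2) by blast
qed

lemma helmholtz_eqI:
  assumes q: "q \<in> L2_sigma \<Omega>" and orth: "\<And>w. w \<in> L2_sigma \<Omega> \<Longrightarrow> (u - q) \<bullet> w = 0"
  shows "helmholtz \<Omega> u = q"
  unfolding helmholtz_def
proof (rule the_equality)
  show "q \<in> L2_sigma \<Omega> \<and> (\<forall>w\<in>L2_sigma \<Omega>. orthogonal (u - q) w)"
    using assms by (simp add: orthogonal_def)
next
  fix r assume r: "r \<in> L2_sigma \<Omega> \<and> (\<forall>w\<in>L2_sigma \<Omega>. orthogonal (u - r) w)"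
  have "(u - q) \<bullet> q = 0" "(u - q) \<bullet> r = 0" "(u - r) \<bullet> q = 0" "(u - r) \<bullet> r = 0"
    using orth q r by (auto simp: orthogonal_def)
  then have "(r - q) \<bullet> (r - q) = 0"
    by (simp add: inner_diff_left inner_diff_right inner_commute)
  then show "r = q" by simp
qed

section \<open>Eigenvectors along the gradient flow\<close>

theorem theorem5p22:
  fixes \<Omega> :: "(real^2) set" and f :: L2 and u p :: "real \<Rightarrow> L2"
  assumes "open \<Omega>" and "bounded \<Omega>"
    and "f \<in> closure (dom_subdiff (L2_on \<Omega>) (J_sum \<Omega>))"
    and "gradient_flow (L2_on \<Omega>) (J_sum \<Omega>) f u p"
  shows "\<forall>t>0. p t \<in> subdiff (L2_on \<Omega>) (J_sum \<Omega>) (p t)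
      \<and> eigenvector (L2_on \<Omega>) (J_div \<Omega>) (p t - helmholtz \<Omega> (p t))
      \<and> eigenvector (L2_on \<Omega>) (J_rot \<Omega>) (helmholtz \<Omega> (p t))"
proof (intro allI impI)
  fix t :: real assume t: "t > 0"
  let ?A = "gradient_fields (\<lambda>y. - y) \<Omega>" and ?B = "gradient_fields rot \<Omega>"
  have J: "J_sum \<Omega> = (\<lambda>v. support_fun ?A v + support_fun ?B v)"
    by (simp add: J_sum_def fun_eq_iff J_div_eq_support_fun J_rot_eq_support_fun)
  have flow: "u t \<in> L2_on \<Omega>" "p t \<in> subdiff (L2_on \<Omega>) (J_sum \<Omega>) (u t)"
    "\<And>q. q \<in> subdiff (L2_on \<Omega>) (J_sum \<Omega>) (u t) \<Longrightarrow> norm (p t) \<le> norm q"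
    using assms(4) t by (auto simp: gradient_flow_def)
  have orth: "a \<bullet> b = 0" if "a \<in> ?A" "b \<in> ?B" for a b
    using gradient_fields_orthogonal_L2_sigma[OF that(1)] rot_gradient_fields_subset_L2_sigma that(2) by blast
  obtain a b where ab: "a \<in> closure ?A" "b \<in> closure ?B" "p t = a + b"
    and eig: "a \<in> subdiff (L2_on \<Omega>) (support_fun ?A) a" "b \<in> subdiff (L2_on \<Omega>) (support_fun ?B) b"
      "p t \<in> subdiff (L2_on \<Omega>) (\<lambda>v. support_fun ?A v + support_fun ?B v) (p t)"
    by (rule minimal_subgradient_orthogonal_eigenvectors[OF subspace_L2_on[OF assms(1)] closed_L2_on[OF assms(1)]
          gradient_fields_subset_L2_on[OF linear_neg] gradient_fields_subset_L2_on[OF linear_rot]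
          convex_gradient_fields[OF linear_neg] convex_gradient_fields[OF linear_rot]
          zero_in_gradient_fields[OF linear_neg] zero_in_gradient_fields[OF linear_rot]
          orth truncatable_gradient_fields[OF linear_neg norm_minus_cancel] truncatable_gradient_fields[OF linear_rot norm_rot]
          flow(2)[unfolded J] flow(1) flow(3)[unfolded J]])
  have "helmholtz \<Omega> (p t) = b"
  proof (rule helmholtz_eqI)
    show "b \<in> L2_sigma \<Omega>"
      using closure_minimal[OF rot_gradient_fields_subset_L2_sigma[of \<Omega>]] ab(2) by (auto simp: L2_sigma_def)
    fix w assume "w \<in> L2_sigma \<Omega>"
    then have w: "w \<in> closure (L2_sigma \<Omega>)" by (rule subsetD[OF closure_subset])
    have "a \<bullet> w = 0"
      by (rule closure_orthogonal[OF _ ab(1) w]) (rule gradient_fields_orthogonal_L2_sigma)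
    then show "(p t - b) \<bullet> w = 0" using ab(3) by simp
  qed
  moreover have "p t - b = a" using ab(3) by simp
  ultimately have h: "helmholtz \<Omega> (p t) = b" "p t - b = a" .
  have eigI: "eigenvector (L2_on \<Omega>) \<Phi> x" if "x \<in> subdiff (L2_on \<Omega>) \<Phi> x" for \<Phi> x
    using that unfolding eigenvector_def by (auto simp: subdiff_def intro!: exI[of _ 1])
  show "p t \<in> subdiff (L2_on \<Omega>) (J_sum \<Omega>) (p t)
      \<and> eigenvector (L2_on \<Omega>) (J_div \<Omega>) (p t - helmholtz \<Omega> (p t))
      \<and> eigenvector (L2_on \<Omega>) (J_rot \<Omega>) (helmholtz \<Omega> (p t))"
    using eig eigI unfolding h J J_div_eq_support_fun J_rot_eq_support_fun by blast
qed

end
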